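(* Let $G$ be a finitely generated $n$-Engel group. Then $\mathfrak{X}(G)$ is $m$-Engel for $m=n+d+s+3$, where $d$ is the nilpotency class of $G/G''$ and $s$ is the nilpotency class of the action of $G$ on $L/L'$.
   Context: A group $\Gamma$ is $n$-Engel if $[a,b,\ldots,b]=1$ for all $a,b\in \Gamma$, where $b$ appears $n$ times; here $[x,y]=x^{-1}y^{-1}xy$ and iterated commutators are left-normed. For a group $H$, $H'=[H,H]$ and $H''=[H',H']$. For a group $G$, let $\overline{G}$ be a second copy of $G$ with a fixed isomorphism $g\mapsto\overline{g}$. The group $\mathfrak{X}(G)$ is the quotient of the free product $G\ast\overline{G}$ by the normal closure of $\{[g,\overline{g}] : g\in G\}$. Let $L$ be the kernel of the surjection $\mathfrak{X}(G)\to G$ that sends both $g$ and $\overline{g}$ to $g$; thus $\mathfrak{X}(G)=L\rtimes G$, and $G$ acts on the abelian group $L/L'$ by conjugation. For finitely generated $G$ this action is nilpotent, and its nilpotency class is the least integer $s\geq 0$ such that $(L/L')\cdot({\rm Aug}(\mathbb{Z}G))^s=0$, i.e. $[\ell,g_1,\dots,g_s]\in L'$ for all $\ell\in L$, $g_i\in G$; here ${\rm Aug}(\mathbb{Z}G)$ is the augmentation ideal. If $G$ is a finitely generated $n$-Engel group, then $G/G''$ is nilpotent by a theorem of Gruenberg, so $d$ is well-defined. *)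

theory Defs
  imports "HOL-Algebra.Algebra"
begin

section \<open>Commutators, Engel groups, nilpotency class\<close>

text \<open>The convention is \<open>[x, y] = x\<inverse> y\<inverse> x y\<close>. The set \<^const>\<open>derived_set\<close> uses
  \<open>x y x\<inverse> y\<inverse>\<close> instead, which generates the same derived subgroup of a subgroup.\<close>

definition commutator :: "('a, 'b) monoid_scheme \<Rightarrow> 'a \<Rightarrow> 'a \<Rightarrow> 'a" where
  "commutator G x y = inv\<^bsub>G\<^esub> x \<otimes>\<^bsub>G\<^esub> inv\<^bsub>G\<^esub> y \<otimes>\<^bsub>G\<^esub> x \<otimes>\<^bsub>G\<^esub> y"

text \<open>\<open>iter_commutator G x [y\<^sub>1, \<dots>, y\<^sub>k] = [x, y\<^sub>1, \<dots>, y\<^sub>k]\<close>, left-normed.\<close>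

definition iter_commutator :: "('a, 'b) monoid_scheme \<Rightarrow> 'a \<Rightarrow> 'a list \<Rightarrow> 'a" where
  "iter_commutator G x ys = foldl (commutator G) x ys"

definition engel :: "nat \<Rightarrow> ('a, 'b) monoid_scheme \<Rightarrow> bool" where
  "engel n G \<longleftrightarrow>
     (\<forall>a \<in> carrier G. \<forall>b \<in> carrier G. iter_commutator G a (replicate n b) = \<one>\<^bsub>G\<^esub>)"

definition finitely_generated_group :: "('a, 'b) monoid_scheme \<Rightarrow> bool" where
  "finitely_generated_group G \<longleftrightarrow>
     (\<exists>S. finite S \<and> S \<subseteq> carrier G \<and> generate G S = carrier G)"

text \<open>\<open>lower_central G i\<close> is the term usually written \<open>\<gamma>\<^sub>i\<^sub>+\<^sub>1(G)\<close>.\<close>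

primrec lower_central :: "('a, 'b) monoid_scheme \<Rightarrow> nat \<Rightarrow> 'a set" where
  "lower_central G 0 = carrier G"
| "lower_central G (Suc i) =
     generate G {commutator G x g | x g. x \<in> lower_central G i \<and> g \<in> carrier G}"

text \<open>Meaningful only if \<open>G\<close> is nilpotent; otherwise the value is unspecified.\<close>

definition nilpotency_class :: "('a, 'b) monoid_scheme \<Rightarrow> nat" where
  "nilpotency_class G = (LEAST c. lower_central G c = {\<one>\<^bsub>G\<^esub>})"

definition second_derived :: "('a, 'b) monoid_scheme \<Rightarrow> 'a set" where
  "second_derived G = derived G (derived G (carrier G))"

definition normal_closure :: "('a, 'b) monoid_scheme \<Rightarrow> 'a set \<Rightarrow> 'a set" where
  "normal_closure G S =
     generate G {g \<otimes>\<^bsub>G\<^esub> x \<otimes>\<^bsub>G\<^esub> inv\<^bsub>G\<^esub> g | g x. g \<in> carrier G \<and> x \<in> S}"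


section \<open>The free product of two groups\<close>

text \<open>Words in the disjoint union of the two carriers, modulo the least congruence that
  multiplies adjacent letters from the same factor and deletes the two neutral letters.\<close>

definition fp_words :: "('a, 'c) monoid_scheme \<Rightarrow> ('b, 'd) monoid_scheme \<Rightarrow> ('a + 'b) list set"
  where "fp_words G H = lists (carrier G <+> carrier H)"

inductive fp_eq :: "('a, 'c) monoid_scheme \<Rightarrow> ('b, 'd) monoid_scheme \<Rightarrow>
    ('a + 'b) list \<Rightarrow> ('a + 'b) list \<Rightarrow> bool"
  for G H where
  refl: "u \<in> fp_words G H \<Longrightarrow> fp_eq G H u u"
| sym: "fp_eq G H u v \<Longrightarrow> fp_eq G H v u"
| trans: "fp_eq G H u v \<Longrightarrow> fp_eq G H v w \<Longrightarrow> fp_eq G H u w"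
| append: "fp_eq G H u u' \<Longrightarrow> fp_eq G H v v' \<Longrightarrow> fp_eq G H (u @ v) (u' @ v')"
| one_left: "fp_eq G H [Inl \<one>\<^bsub>G\<^esub>] []"
| one_right: "fp_eq G H [Inr \<one>\<^bsub>H\<^esub>] []"
| mult_left: "x \<in> carrier G \<Longrightarrow> y \<in> carrier G \<Longrightarrow>
    fp_eq G H [Inl x, Inl y] [Inl (x \<otimes>\<^bsub>G\<^esub> y)]"
| mult_right: "x \<in> carrier H \<Longrightarrow> y \<in> carrier H \<Longrightarrow>
    fp_eq G H [Inr x, Inr y] [Inr (x \<otimes>\<^bsub>H\<^esub> y)]"

definition fp_class :: "('a, 'c) monoid_scheme \<Rightarrow> ('b, 'd) monoid_scheme \<Rightarrow>
    ('a + 'b) list \<Rightarrow> ('a + 'b) list set" where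
  "fp_class G H u = {v. fp_eq G H u v}"

definition free_product :: "('a, 'c) monoid_scheme \<Rightarrow> ('b, 'd) monoid_scheme \<Rightarrow>
    ('a + 'b) list set monoid" where
  "free_product G H =
     \<lparr>carrier = fp_class G H ` fp_words G H,
      monoid.mult = (\<lambda>A B. \<Union>u\<in>A. \<Union>v\<in>B. fp_class G H (u @ v)),
      monoid.one = fp_class G H []\<rparr>"

definition fp_inl :: "('a, 'c) monoid_scheme \<Rightarrow> ('b, 'd) monoid_scheme \<Rightarrow> 'a \<Rightarrow> ('a + 'b) list set"
  where "fp_inl G H x = fp_class G H [Inl x]"

definition fp_inr :: "('a, 'c) monoid_scheme \<Rightarrow> ('b, 'd) monoid_scheme \<Rightarrow> 'b \<Rightarrow> ('a + 'b) list set"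
  where "fp_inr G H y = fp_class G H [Inr y]"

definition fp_eval :: "('k, 'e) monoid_scheme \<Rightarrow> ('a \<Rightarrow> 'k) \<Rightarrow> ('b \<Rightarrow> 'k) \<Rightarrow> ('a + 'b) list \<Rightarrow> 'k"
  where "fp_eval K f g w = foldr (\<lambda>x k. case_sum f g x \<otimes>\<^bsub>K\<^esub> k) w \<one>\<^bsub>K\<^esub>"

definition fp_lift :: "('k, 'e) monoid_scheme \<Rightarrow> ('a \<Rightarrow> 'k) \<Rightarrow> ('b \<Rightarrow> 'k) \<Rightarrow>
    ('a + 'b) list set \<Rightarrow> 'k"
  where "fp_lift K f g A = the_elem (fp_eval K f g ` A)"

context
  fixes G :: "('a, 'c) monoid_scheme" and H :: "('b, 'd) monoid_scheme"
  assumes G: "group G" and H: "group H"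
begin

interpretation G: group G by (rule G)
interpretation H: group H by (rule H)

lemma fp_words_simps [simp]:
  "[] \<in> fp_words G H"
  "Inl x # w \<in> fp_words G H \<longleftrightarrow> x \<in> carrier G \<and> w \<in> fp_words G H"
  "Inr y # w \<in> fp_words G H \<longleftrightarrow> y \<in> carrier H \<and> w \<in> fp_words G H"
  "u @ v \<in> fp_words G H \<longleftrightarrow> u \<in> fp_words G H \<and> v \<in> fp_words G H"
  by (auto simp: fp_words_def)

lemma fp_eq_words: "fp_eq G H u v \<Longrightarrow> u \<in> fp_words G H \<and> v \<in> fp_words G H"
  by (induction rule: fp_eq.induct) auto

lemma fp_class_eq_iff:
  "u \<in> fp_words G H \<Longrightarrow> fp_class G H u = fp_class G H v \<longleftrightarrow> fp_eq G H u v"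
  unfolding fp_class_def by (blast intro: fp_eq.refl fp_eq.sym fp_eq.trans)

lemma fp_mult:
  assumes "u \<in> fp_words G H" "v \<in> fp_words G H"
  shows "fp_class G H u \<otimes>\<^bsub>free_product G H\<^esub> fp_class G H v = fp_class G H (u @ v)"
proof -
  have "fp_class G H (u' @ v') = fp_class G H (u @ v)"
    if "u' \<in> fp_class G H u" "v' \<in> fp_class G H v" for u' v'
  proof -
    from that have "fp_eq G H (u @ v) (u' @ v')"
      by (simp add: fp_class_def fp_eq.append)
    with assms show ?thesis by (simp add: fp_class_eq_iff[of "u @ v" "u' @ v'", symmetric])
  qed
  moreover have "u \<in> fp_class G H u" "v \<in> fp_class G H v"
    using assms by (simp_all add: fp_class_def fp_eq.refl)
  ultimately have "(\<Union>u'\<in>fp_class G H u. \<Union>v'\<in>fp_class G H v. fp_class G H (u' @ v'))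
      = fp_class G H (u @ v)"
    by blast
  then show ?thesis by (simp add: free_product_def)
qed

lemma fp_left_inverse:
  assumes "u \<in> fp_words G H"
  shows "\<exists>v \<in> fp_words G H. fp_eq G H (v @ u) []"
  using assms
proof (induction u)
  case Nil
  show ?case by (rule bexI[of _ "[]"]) (simp_all add: fp_eq.refl)
next
  case (Cons a u)
  from Cons.prems have u: "u \<in> fp_words G H" by (cases a) auto
  with Cons.IH obtain v where v: "v \<in> fp_words G H" "fp_eq G H (v @ u) []" by blast
  have "\<exists>b. [b] \<in> fp_words G H \<and> fp_eq G H [b, a] []"
  proof (cases a)
    case (Inl x)
    with Cons.prems have x: "x \<in> carrier G" by auto
    have "fp_eq G H [Inl (inv\<^bsub>G\<^esub> x), Inl x] [Inl \<one>\<^bsub>G\<^esub>]"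
      using fp_eq.mult_left[of "inv\<^bsub>G\<^esub> x" G x H] x by simp
    from fp_eq.trans[OF this fp_eq.one_left] x Inl show ?thesis
      by (intro exI[of _ "Inl (inv\<^bsub>G\<^esub> x)"]) simp
  next
    case (Inr x)
    with Cons.prems have x: "x \<in> carrier H" by auto
    have "fp_eq G H [Inr (inv\<^bsub>H\<^esub> x), Inr x] [Inr \<one>\<^bsub>H\<^esub>]"
      using fp_eq.mult_right[of "inv\<^bsub>H\<^esub> x" H x G] x by simp
    from fp_eq.trans[OF this fp_eq.one_right] x Inr show ?thesis
      by (intro exI[of _ "Inr (inv\<^bsub>H\<^esub> x)"]) simp
  qed
  then obtain b where b: "[b] \<in> fp_words G H" "fp_eq G H [b, a] []" by blast
  have "fp_eq G H (v @ ([b, a] @ u)) (v @ ([] @ u))"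
    using u v b by (intro fp_eq.append fp_eq.refl) auto
  hence "fp_eq G H (v @ b # a # u) (v @ u)" by simp
  from fp_eq.trans[OF this v(2)] b v show ?case by (intro bexI[of _ "v @ [b]"]) simp_all
qed

lemma group_free_product: "group (free_product G H)"
proof (rule groupI)
  fix A B assume "A \<in> carrier (free_product G H)" "B \<in> carrier (free_product G H)"
  then obtain u v where uv: "u \<in> fp_words G H" "v \<in> fp_words G H"
    "A = fp_class G H u" "B = fp_class G H v"
    by (auto simp: free_product_def)
  then show "A \<otimes>\<^bsub>free_product G H\<^esub> B \<in> carrier (free_product G H)"
    by (simp add: fp_mult) (simp add: free_product_def)
  fix C assume "C \<in> carrier (free_product G H)"
  then obtain w where "w \<in> fp_words G H" "C = fp_class G H w" by (auto simp: free_product_def)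
  with uv show "A \<otimes>\<^bsub>free_product G H\<^esub> B \<otimes>\<^bsub>free_product G H\<^esub> C
    = A \<otimes>\<^bsub>free_product G H\<^esub> (B \<otimes>\<^bsub>free_product G H\<^esub> C)"
    by (simp add: fp_mult)
next
  show "\<one>\<^bsub>free_product G H\<^esub> \<in> carrier (free_product G H)" by (simp add: free_product_def)
next
  have one: "\<one>\<^bsub>free_product G H\<^esub> = fp_class G H []" by (simp add: free_product_def)
  fix A assume "A \<in> carrier (free_product G H)"
  then obtain u where u: "u \<in> fp_words G H" "A = fp_class G H u" by (auto simp: free_product_def)
  then show "\<one>\<^bsub>free_product G H\<^esub> \<otimes>\<^bsub>free_product G H\<^esub> A = A" by (simp add: one fp_mult)
  from fp_left_inverse[OF u(1)] obtain v where v: "v \<in> fp_words G H" "fp_eq G H (v @ u) []"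
    by blast
  then have "fp_class G H v \<otimes>\<^bsub>free_product G H\<^esub> A = \<one>\<^bsub>free_product G H\<^esub>"
    using u by (simp add: one fp_mult fp_class_eq_iff)
  moreover have "fp_class G H v \<in> carrier (free_product G H)"
    using v by (simp add: free_product_def)
  ultimately show "\<exists>B \<in> carrier (free_product G H). B \<otimes>\<^bsub>free_product G H\<^esub> A = \<one>\<^bsub>free_product G H\<^esub>"
    by blast
qed

lemma fp_inl_hom: "fp_inl G H \<in> hom G (free_product G H)"
proof (rule homI)
  fix x y assume xy: "x \<in> carrier G" "y \<in> carrier G"
  then show "fp_inl G H (x \<otimes>\<^bsub>G\<^esub> y) = fp_inl G H x \<otimes>\<^bsub>free_product G H\<^esub> fp_inl G H y"
    by (simp add: fp_inl_def fp_mult fp_class_eq_iff fp_eq.mult_left fp_eq.sym)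
qed (simp add: fp_inl_def free_product_def)

lemma fp_inr_hom: "fp_inr G H \<in> hom H (free_product G H)"
proof (rule homI)
  fix x y assume xy: "x \<in> carrier H" "y \<in> carrier H"
  then show "fp_inr G H (x \<otimes>\<^bsub>H\<^esub> y) = fp_inr G H x \<otimes>\<^bsub>free_product G H\<^esub> fp_inr G H y"
    by (simp add: fp_inr_def fp_mult fp_class_eq_iff fp_eq.mult_right fp_eq.sym)
qed (simp add: fp_inr_def free_product_def)

context
  fixes K :: "('k, 'e) monoid_scheme" and f :: "'a \<Rightarrow> 'k" and g :: "'b \<Rightarrow> 'k"
  assumes K: "group K" and f: "f \<in> hom G K" and g: "g \<in> hom H K"
begin

interpretation K: group K by (rule K)
interpretation f: group_hom G K f using G K f by (simp add: group_hom_def group_hom_axioms_def)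
interpretation g: group_hom H K g using H K g by (simp add: group_hom_def group_hom_axioms_def)

lemma fp_eval_closed: "w \<in> fp_words G H \<Longrightarrow> fp_eval K f g w \<in> carrier K"
proof (induction w)
  case (Cons a w)
  then show ?case by (cases a) (auto simp: fp_eval_def)
qed (simp add: fp_eval_def)

lemma fp_eval_append:
  "u \<in> fp_words G H \<Longrightarrow> v \<in> fp_words G H \<Longrightarrow>
    fp_eval K f g (u @ v) = fp_eval K f g u \<otimes>\<^bsub>K\<^esub> fp_eval K f g v"
proof (induction u)
  case Nil
  then show ?case using fp_eval_closed by (simp add: fp_eval_def)
next
  case (Cons a u)
  have step: "fp_eval K f g (b # w) = case_sum f g b \<otimes>\<^bsub>K\<^esub> fp_eval K f g w" for b w
    by (simp add: fp_eval_def)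
  from Cons show ?case
    by (cases a) (auto simp: step K.m_assoc fp_eval_closed)
qed

lemma fp_eval_cong: "fp_eq G H u v \<Longrightarrow> fp_eval K f g u = fp_eval K f g v"
proof (induction rule: fp_eq.induct)
  case (append u u' v v')
  with fp_eq_words[OF append.hyps(1)] fp_eq_words[OF append.hyps(2)] show ?case
    by (simp add: fp_eval_append)
qed (auto simp: fp_eval_def)

lemma fp_lift_class:
  assumes "w \<in> fp_words G H"
  shows "fp_lift K f g (fp_class G H w) = fp_eval K f g w"
proof -
  have "fp_eval K f g ` fp_class G H w = {fp_eval K f g w}"
    using assms by (auto simp: fp_class_def dest: fp_eval_cong intro: fp_eq.refl)
  then show ?thesis by (simp add: fp_lift_def)
qed

lemma fp_lift_hom: "fp_lift K f g \<in> hom (free_product G H) K"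
proof (rule homI)
  fix A B assume "A \<in> carrier (free_product G H)" "B \<in> carrier (free_product G H)"
  then obtain u v where uv: "u \<in> fp_words G H" "v \<in> fp_words G H"
    "A = fp_class G H u" "B = fp_class G H v"
    by (auto simp: free_product_def)
  then show "fp_lift K f g A \<in> carrier K" by (simp add: fp_lift_class fp_eval_closed)
  from uv show "fp_lift K f g (A \<otimes>\<^bsub>free_product G H\<^esub> B) = fp_lift K f g A \<otimes>\<^bsub>K\<^esub> fp_lift K f g B"
    by (simp add: fp_mult fp_lift_class fp_eval_append)
qed

lemma fp_lift_inl: "x \<in> carrier G \<Longrightarrow> fp_lift K f g (fp_inl G H x) = f x"
  by (simp add: fp_inl_def fp_lift_class) (simp add: fp_eval_def)

lemma fp_lift_inr: "y \<in> carrier H \<Longrightarrow> fp_lift K f g (fp_inr G H y) = g y"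
  by (simp add: fp_inr_def fp_lift_class) (simp add: fp_eval_def)

lemma fp_lift_unique:
  assumes h: "h \<in> hom (free_product G H) K"
    and hl: "\<And>x. x \<in> carrier G \<Longrightarrow> h (fp_inl G H x) = f x"
    and hr: "\<And>y. y \<in> carrier H \<Longrightarrow> h (fp_inr G H y) = g y"
    and A: "A \<in> carrier (free_product G H)"
  shows "h A = fp_lift K f g A"
proof -
  interpret h: group_hom "free_product G H" K h
    using group_free_product K h by (simp add: group_hom_def group_hom_axioms_def)
  have car: "fp_class G H w \<in> carrier (free_product G H)" if "w \<in> fp_words G H" for w
    using that by (simp add: free_product_def)
  have "h (fp_class G H w) = fp_eval K f g w" if "w \<in> fp_words G H" for w
    using that
  proof (induction w)
    case Nil
    have "\<one>\<^bsub>free_product G H\<^esub> = fp_class G H []" by (simp add: free_product_def)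
    with h.hom_one show ?case by (simp add: fp_eval_def)
  next
    case (Cons a w)
    then have w: "w \<in> fp_words G H" and a: "[a] \<in> fp_words G H" by (cases a; simp)+
    have "h (fp_class G H (a # w)) = h (fp_class G H [a]) \<otimes>\<^bsub>K\<^esub> fp_eval K f g w"
      using fp_mult[OF a w] h.hom_mult[OF car[OF a] car[OF w]] Cons.IH[OF w] by simp
    moreover have "h (fp_class G H [a]) = case_sum f g a"
      using a hl hr by (cases a) (auto simp: fp_inl_def fp_inr_def)
    ultimately show ?case by (simp add: fp_eval_def)
  qed
  with A show ?thesis by (auto simp: free_product_def fp_lift_class)
qed

end

end

lemma (in group) normal_closure_normal:
  assumes "S \<subseteq> carrier G"
  shows "normal_closure G S \<lhd> G"
  unfolding normal_closure_def
proof (rule normal_generateI)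
  show "{g \<otimes> x \<otimes> inv g | g x. g \<in> carrier G \<and> x \<in> S} \<subseteq> carrier G"
    using assms by auto
  fix h k assume "h \<in> {g \<otimes> x \<otimes> inv g | g x. g \<in> carrier G \<and> x \<in> S}" and k: "k \<in> carrier G"
  then obtain g x where gx: "g \<in> carrier G" "x \<in> S" "h = g \<otimes> x \<otimes> inv g" by auto
  with assms have x: "x \<in> carrier G" by auto
  have "k \<otimes> h \<otimes> inv k = (k \<otimes> g) \<otimes> x \<otimes> inv (k \<otimes> g)"
    using gx x k by (simp add: m_assoc inv_mult_group)
  with gx k show "k \<otimes> h \<otimes> inv k \<in> {g \<otimes> x \<otimes> inv g | g x. g \<in> carrier G \<and> x \<in> S}"
    by blast
qed

lemma (in group) normal_closure_least:
  assumes "N \<lhd> G" "S \<subseteq> N"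
  shows "normal_closure G S \<subseteq> N"
  unfolding normal_closure_def
  using assms normal.inv_op_closed2[OF assms(1)]
  by (intro generate_subgroup_incl normal_imp_subgroup) auto


section \<open>The group \<open>\<XX>(G)\<close>\<close>

text \<open>The second copy of \<open>G\<close> is the right factor of the free product of \<open>G\<close> with itself,
  so that \<open>g\<close> is \<open>fp_inl G G g\<close> and its copy is \<open>fp_inr G G g\<close>.\<close>

definition XX_relators :: "('a, 'b) monoid_scheme \<Rightarrow> ('a + 'a) list set set" where
  "XX_relators G = {commutator (free_product G G) (fp_inl G G g) (fp_inr G G g) | g. g \<in> carrier G}"

definition XX :: "('a, 'b) monoid_scheme \<Rightarrow> ('a + 'a) list set set monoid" where
  "XX G = free_product G G Mod normal_closure (free_product G G) (XX_relators G)"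

definition XX_quot :: "('a, 'b) monoid_scheme \<Rightarrow> ('a + 'a) list set \<Rightarrow> ('a + 'a) list set set" where
  "XX_quot G A = normal_closure (free_product G G) (XX_relators G) #>\<^bsub>free_product G G\<^esub> A"

definition XX_inl :: "('a, 'b) monoid_scheme \<Rightarrow> 'a \<Rightarrow> ('a + 'a) list set set" where
  "XX_inl G g = XX_quot G (fp_inl G G g)"

definition XX_inr :: "('a, 'b) monoid_scheme \<Rightarrow> 'a \<Rightarrow> ('a + 'a) list set set" where
  "XX_inr G g = XX_quot G (fp_inr G G g)"

text \<open>The homomorphism sending both \<open>g\<close> and its copy to \<open>g\<close>, induced on cosets.\<close>

definition XX_proj :: "('a, 'b) monoid_scheme \<Rightarrow> ('a + 'a) list set set \<Rightarrow> 'a" where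
  "XX_proj G C = the_elem (fp_lift G (\<lambda>g. g) (\<lambda>g. g) ` C)"

definition XX_L :: "('a, 'b) monoid_scheme \<Rightarrow> ('a + 'a) list set set set" where
  "XX_L G = kernel (XX G) G (XX_proj G)"

text \<open>\<open>G\<close> acts on \<open>L/L'\<close> by conjugation through \<open>XX_inl G\<close>, and the coset of
  \<open>[\<ell>, g\<^sub>1, \<dots>, g\<^sub>s]\<close> is the image of the coset of \<open>\<ell>\<close> under \<open>(g\<^sub>1 - 1) \<cdots> (g\<^sub>s - 1)\<close>. The value
  is meaningful only if the action is nilpotent, as it is for finitely generated \<open>G\<close>.\<close>

definition L_action_class :: "('a, 'b) monoid_scheme \<Rightarrow> nat" where
  "L_action_class G =
     (LEAST s. \<forall>l \<in> XX_L G. \<forall>gs. set gs \<subseteq> carrier G \<and> length gs = s \<longrightarrow>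
        iter_commutator (XX G) l (map (XX_inl G) gs) \<in> derived (XX G) (XX_L G))"

context
  fixes G :: "('a, 'b) monoid_scheme"
  assumes G: "group G"
begin

interpretation G: group G by (rule G)
interpretation F: group "free_product G G" by (rule group_free_product[OF G G])

lemma XX_relators_closed: "XX_relators G \<subseteq> carrier (free_product G G)"
  using hom_in_carrier[OF fp_inl_hom[OF G G]] hom_in_carrier[OF fp_inr_hom[OF G G]]
  by (auto simp: XX_relators_def commutator_def)

interpretation N: normal "normal_closure (free_product G G) (XX_relators G)" "free_product G G"
  by (rule F.normal_closure_normal[OF XX_relators_closed])

lemma group_XX: "group (XX G)"
  unfolding XX_def by (rule N.factorgroup_is_group)

lemma XX_quot_hom: "XX_quot G \<in> hom (free_product G G) (XX G)"
  unfolding XX_def using N.r_coset_hom_Mod by (simp add: XX_quot_def[abs_def])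

lemma XX_inl_hom: "XX_inl G \<in> hom G (XX G)"
  using hom_compose[OF fp_inl_hom[OF G G] XX_quot_hom] by (simp add: XX_inl_def[abs_def] comp_def)

lemma XX_inr_hom: "XX_inr G \<in> hom G (XX G)"
  using hom_compose[OF fp_inr_hom[OF G G] XX_quot_hom] by (simp add: XX_inr_def[abs_def] comp_def)

lemma XX_proj_quot:
  assumes A: "A \<in> carrier (free_product G G)"
  shows "XX_proj G (XX_quot G A) = fp_lift G (\<lambda>g. g) (\<lambda>g. g) A"
proof -
  have id: "(\<lambda>g. g) \<in> hom G G" by (rule homI) auto
  let ?p = "fp_lift G (\<lambda>g. g) (\<lambda>g. g)"
  interpret p: group_hom "free_product G G" G ?p
    using fp_lift_hom[OF G G G id id] by unfold_locales
  have "XX_relators G \<subseteq> kernel (free_product G G) G ?p"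
  proof -
    have "?p (commutator (free_product G G) (fp_inl G G g) (fp_inr G G g)) = \<one>\<^bsub>G\<^esub>"
      if g: "g \<in> carrier G" for g
      using g hom_in_carrier[OF fp_inl_hom[OF G G] g] hom_in_carrier[OF fp_inr_hom[OF G G] g]
      by (simp add: commutator_def fp_lift_inl[OF G G G id id] fp_lift_inr[OF G G G id id] G.m_assoc)
    then show ?thesis using XX_relators_closed by (auto simp: kernel_def XX_relators_def)
  qed
  then have N: "normal_closure (free_product G G) (XX_relators G) \<subseteq> kernel (free_product G G) G ?p"
    by (rule F.normal_closure_least[OF p.normal_kernel])
  have "?p B = ?p A" if "B \<in> XX_quot G A" for B
    using that N A by (auto simp: XX_quot_def r_coset_def kernel_def)
  moreover have "A \<in> XX_quot G A"
    unfolding XX_quot_def by (rule F.rcos_self[OF A N.is_subgroup])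
  ultimately have "?p ` XX_quot G A = {?p A}" by blast
  then show ?thesis by (simp add: XX_proj_def)
qed

lemma XX_proj_hom: "XX_proj G \<in> hom (XX G) G"
proof (rule homI)
  have id: "(\<lambda>g. g) \<in> hom G G" by (rule homI) auto
  note p = fp_lift_hom[OF G G G id id]
  fix C D assume "C \<in> carrier (XX G)" "D \<in> carrier (XX G)"
  then obtain A B where AB: "A \<in> carrier (free_product G G)" "B \<in> carrier (free_product G G)"
    "C = XX_quot G A" "D = XX_quot G B"
    by (auto simp: XX_def FactGroup_def RCOSETS_def XX_quot_def)
  then show "XX_proj G C \<in> carrier G" by (simp add: XX_proj_quot hom_in_carrier[OF p])
  have "C \<otimes>\<^bsub>XX G\<^esub> D = XX_quot G (A \<otimes>\<^bsub>free_product G G\<^esub> B)"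
    using AB by (simp add: hom_mult[OF XX_quot_hom])
  with AB show "XX_proj G (C \<otimes>\<^bsub>XX G\<^esub> D) = XX_proj G C \<otimes>\<^bsub>G\<^esub> XX_proj G D"
    by (simp add: XX_proj_quot hom_mult[OF p])
qed

lemma XX_proj_inl: "g \<in> carrier G \<Longrightarrow> XX_proj G (XX_inl G g) = g"
proof -
  assume g: "g \<in> carrier G"
  have id: "(\<lambda>g. g) \<in> hom G G" by (rule homI) auto
  from g show ?thesis
    by (simp add: XX_inl_def XX_proj_quot hom_in_carrier[OF fp_inl_hom[OF G G]]
        fp_lift_inl[OF G G G id id])
qed

lemma XX_proj_inr: "g \<in> carrier G \<Longrightarrow> XX_proj G (XX_inr G g) = g"
proof -
  assume g: "g \<in> carrier G"
  have id: "(\<lambda>g. g) \<in> hom G G" by (rule homI) auto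
  from g show ?thesis
    by (simp add: XX_inr_def XX_proj_quot hom_in_carrier[OF fp_inr_hom[OF G G]]
        fp_lift_inr[OF G G G id id])
qed

lemma XX_L_normal: "XX_L G \<lhd> XX G"
  unfolding XX_L_def
  by (rule group_hom.normal_kernel)
    (simp add: group_hom_def group_hom_axioms_def G group_XX XX_proj_hom)

end

end

theory Submission
  imports Defs
begin

text \<open>Write \<open>g\<close>, \<open>g'\<close> for the two copies of an element \<open>g\<close> of \<open>G\<close>, and let \<open>L\<close>, \<open>K\<^sub>1\<close>, \<open>K\<^sub>3\<close> be the
  kernels of the homomorphisms from \<open>\<XX>(G)\<close> to \<open>G\<close> that map the pair \<open>(g, g')\<close> to \<open>(g, g)\<close>,
  \<open>(g, 1)\<close>, \<open>(1, g)\<close> respectively. The elements of \<open>K\<^sub>1 \<inter> K\<^sub>3\<close> centralize \<open>L\<close>, so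
  \<open>W = L \<inter> K\<^sub>1 \<inter> K\<^sub>3\<close> is central in \<open>L\<close>, and on \<open>W\<close> an element \<open>y\<close> acts as either
  copy \<open>g\<close>, \<open>g'\<close> of its image in \<open>G\<close>. As \<open>\<XX>(G)/W\<close> embeds in \<open>G \<times> G \<times> G\<close>, \<open>n\<close>
  commutations with \<open>y\<close> lead into \<open>W\<close>, and \<open>s\<close> more into \<open>W \<inter> L'\<close>. With \<open>M\<^sub>1 = L \<inter> K\<^sub>1\<close> and
  \<open>M\<^sub>3 = L \<inter> K\<^sub>3\<close>, commutation with \<open>g\<close> takes \<open>L\<close> into \<open>M\<^sub>3\<close> and \<open>M\<^sub>1\<close> into \<open>W\<close>, and commutation with
  \<open>g'\<close> takes \<open>L\<close> into \<open>M\<^sub>1\<close> and \<open>M\<^sub>3\<close> into \<open>W\<close>; hence \<open>[L', g]\<close> lies in \<open>[M\<^sub>3, L]\<close> and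
  \<open>[[M\<^sub>3, L], g']\<close> in \<open>[M\<^sub>3, M\<^sub>1]\<close>. Finally \<open>[[a, b], g] = [[a, g], b]\<close> for \<open>a \<in> M\<^sub>3\<close>, \<open>b \<in> M\<^sub>1\<close>, and \<open>b\<close>
  commutes with all \<open>a\<close> lying over \<open>G''\<close>, so \<open>d\<close> further commutations suffice.\<close>

section \<open>Commutator calculus\<close>

lemma iter_commutator_Nil [simp]: "iter_commutator G a [] = a"
  and iter_commutator_Cons [simp]:
    "iter_commutator G a (g # gs) = iter_commutator G (commutator G a g) gs"
  and iter_commutator_append:
    "iter_commutator G a (gs @ hs) = iter_commutator G (iter_commutator G a gs) hs"
  by (simp_all add: iter_commutator_def)

context group
begin

lemma inv_mult_cancel [simp]:
  "x \<in> carrier G \<Longrightarrow> y \<in> carrier G \<Longrightarrow> inv x \<otimes> (x \<otimes> y) = y"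
  "x \<in> carrier G \<Longrightarrow> y \<in> carrier G \<Longrightarrow> x \<otimes> (inv x \<otimes> y) = y"
  by (simp_all add: m_assoc [symmetric])

lemma commutator_closed [simp, intro]:
  "x \<in> carrier G \<Longrightarrow> y \<in> carrier G \<Longrightarrow> commutator G x y \<in> carrier G"
  by (simp add: commutator_def)

lemma iter_commutator_closed [simp, intro]:
  "x \<in> carrier G \<Longrightarrow> set ys \<subseteq> carrier G \<Longrightarrow> iter_commutator G x ys \<in> carrier G"
  by (induction ys arbitrary: x) auto

lemma mult_eq_iff_commutator:
  "x \<in> carrier G \<Longrightarrow> y \<in> carrier G \<Longrightarrow> x \<otimes> y = y \<otimes> x \<otimes> commutator G x y"
  by (simp add: commutator_def m_assoc)

lemma commutator_eq_one_iff:
  assumes "x \<in> carrier G" "y \<in> carrier G"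
  shows "commutator G x y = \<one> \<longleftrightarrow> x \<otimes> y = y \<otimes> x"
  using assms mult_eq_iff_commutator[OF assms] by auto

lemma commutator_one [simp]:
  "x \<in> carrier G \<Longrightarrow> commutator G x \<one> = \<one>"
  "x \<in> carrier G \<Longrightarrow> commutator G \<one> x = \<one>"
  by (simp_all add: commutator_eq_one_iff)

lemma iter_commutator_one [simp]:
  "set ys \<subseteq> carrier G \<Longrightarrow> iter_commutator G \<one> ys = \<one>"
  by (induction ys) auto

lemma inv_commutator:
  "x \<in> carrier G \<Longrightarrow> y \<in> carrier G \<Longrightarrow> inv (commutator G x y) = commutator G y x"
  by (simp add: commutator_def m_assoc inv_mult_group)

lemma conj_eq_mult_commutator:
  "x \<in> carrier G \<Longrightarrow> g \<in> carrier G \<Longrightarrow> inv g \<otimes> x \<otimes> g = x \<otimes> commutator G x g"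
  by (simp add: commutator_def m_assoc)

lemma commutator_mult_right:
  assumes "a \<in> carrier G" "g \<in> carrier G" "h \<in> carrier G"
  shows "commutator G a (g \<otimes> h) = commutator G a h \<otimes> (inv h \<otimes> commutator G a g \<otimes> h)"
  using assms by (simp add: commutator_def m_assoc inv_mult_group)

lemma commutator_mult_left:
  assumes "a \<in> carrier G" "b \<in> carrier G" "g \<in> carrier G"
  shows "commutator G (a \<otimes> b) g = inv b \<otimes> commutator G a g \<otimes> b \<otimes> commutator G b g"
  using assms by (simp add: commutator_def m_assoc inv_mult_group)

lemma commutator_mem_normal:
  assumes "N \<lhd> G" "g \<in> carrier G"
  shows "a \<in> N \<Longrightarrow> commutator G a g \<in> N" and "a \<in> N \<Longrightarrow> commutator G g a \<in> N"
proof -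
  interpret N: normal N G by fact
  show *: "commutator G a g \<in> N" if "a \<in> N" for a
  proof -
    have "inv a \<otimes> (inv g \<otimes> a \<otimes> g) \<in> N"
      using that assms by (intro N.m_closed N.m_inv_closed N.inv_op_closed1) auto
    then show ?thesis
      using that assms N.mem_carrier by (simp add: commutator_def m_assoc)
  qed
  show "commutator G g a \<in> N" if "a \<in> N"
    using N.m_inv_closed[OF *[OF that]] that assms N.mem_carrier by (simp add: inv_commutator)
qed

lemma iter_commutator_mem_normal:
  assumes "N \<lhd> G" "a \<in> N" "set gs \<subseteq> carrier G"
  shows "iter_commutator G a gs \<in> N"
  using assms(2,3) by (induction gs arbitrary: a) (auto intro: commutator_mem_normal[OF assms(1)])

text \<open>The preimage of the centralizer of the image of \<open>g\<close> in
  \<open>G Mod C\<close>; it allows commutator conditions modulo \<open>C\<close> to be checked on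
  generators.\<close>

lemma subgroup_commutator_mem:
  assumes "C \<lhd> G" "g \<in> carrier G"
  shows "subgroup {z \<in> carrier G. commutator G z g \<in> C} G"
proof -
  interpret C: normal C G by fact
  show ?thesis
  proof (rule subgroupI)
    show "{z \<in> carrier G. commutator G z g \<in> C} \<noteq> {}"
      using assms by (auto intro!: exI[of _ \<one>])
    fix a assume a: "a \<in> {z \<in> carrier G. commutator G z g \<in> C}"
    have "a \<otimes> inv (commutator G a g) \<otimes> inv a \<in> C"
      using a by (intro C.inv_op_closed2 C.m_inv_closed) auto
    moreover have "commutator G (inv a) g = a \<otimes> inv (commutator G a g) \<otimes> inv a"
      using a assms by (simp add: commutator_def m_assoc inv_mult_group)
    ultimately show "inv a \<in> {z \<in> carrier G. commutator G z g \<in> C}" using a by simp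
    fix b assume b: "b \<in> {z \<in> carrier G. commutator G z g \<in> C}"
    show "a \<otimes> b \<in> {z \<in> carrier G. commutator G z g \<in> C}"
      using a b assms C.inv_op_closed1[of b "commutator G a g"]
      by (auto simp: commutator_mult_left)
  qed auto
qed

lemma commutator_mem_generate:
  assumes "C \<lhd> G" "g \<in> carrier G" "T \<subseteq> carrier G" "z \<in> generate G T"
    and "\<And>t. t \<in> T \<Longrightarrow> commutator G t g \<in> C"
  shows "commutator G z g \<in> C"
  using generate_subgroup_incl[OF _ subgroup_commutator_mem[OF assms(1,2)], of T] assms(3-5)
  by blast

text \<open>The hypotheses allow \<open>u\<close> and \<open>v\<close> to be moved to the end of
  both sides of ab = ba[a, b], which turns it into the same relation for
  \<open>a \<otimes> u\<close> and \<open>b \<otimes> v\<close>.\<close>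

lemma commutator_perturb:
  assumes [simp]: "a \<in> carrier G" "b \<in> carrier G" "u \<in> carrier G" "v \<in> carrier G"
    and ub: "commutator G u b = \<one>" and uv: "commutator G u v = \<one>"
    and av: "commutator G a v = \<one>"
    and cu: "commutator G (commutator G a b) u = \<one>"
    and cv: "commutator G (commutator G a b) v = \<one>"
  shows "commutator G (a \<otimes> u) (b \<otimes> v) = commutator G a b"
proof -
  have 1: "u \<otimes> b = b \<otimes> u" "a \<otimes> v = v \<otimes> a" "u \<otimes> v = v \<otimes> u"
    using ub uv av by (simp_all add: commutator_eq_one_iff)
  have c: "commutator G a b \<otimes> u = u \<otimes> commutator G a b"
     "commutator G a b \<otimes> v = v \<otimes> commutator G a b"
    using cu cv by (simp_all add: commutator_eq_one_iff)
  have "(b \<otimes> v) \<otimes> (a \<otimes> u) \<otimes> commutator G a b = b \<otimes> (v \<otimes> a) \<otimes> (u \<otimes> commutator G a b)"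
    by (simp add: m_assoc)
  also have "\<dots> = b \<otimes> a \<otimes> (v \<otimes> commutator G a b) \<otimes> u"
    by (simp add: m_assoc 1(2)[symmetric] c(1)[symmetric])
  also have "\<dots> = b \<otimes> a \<otimes> commutator G a b \<otimes> (u \<otimes> v)"
    by (simp only: c(2)[symmetric] 1(3)) (simp add: m_assoc)
  also have "\<dots> = a \<otimes> (b \<otimes> u) \<otimes> v"
    by (simp add: mult_eq_iff_commutator[of a b, symmetric]) (simp add: m_assoc)
  also have "\<dots> = (a \<otimes> u) \<otimes> (b \<otimes> v)"
    by (simp add: 1(1)[symmetric] m_assoc)
  also have "\<dots> = (b \<otimes> v) \<otimes> (a \<otimes> u) \<otimes> commutator G (a \<otimes> u) (b \<otimes> v)"
    by (rule mult_eq_iff_commutator) auto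
  finally show ?thesis by simp
qed

lemma conj_hom: "g \<in> carrier G \<Longrightarrow> (\<lambda>x. inv g \<otimes> x \<otimes> g) \<in> hom G G"
  by (rule homI) (simp_all add: m_assoc)

end

context group_hom
begin

lemma hom_commutator:
  "x \<in> carrier G \<Longrightarrow> y \<in> carrier G \<Longrightarrow> h (commutator G x y) = commutator H (h x) (h y)"
  by (simp add: commutator_def)

lemma hom_iter_commutator:
  "x \<in> carrier G \<Longrightarrow> set ys \<subseteq> carrier G \<Longrightarrow>
    h (iter_commutator G x ys) = iter_commutator H (h x) (map h ys)"
  by (induction ys arbitrary: x) (auto simp: hom_commutator)

end

lemma (in group) conj_commutator:
  assumes "x \<in> carrier G" "y \<in> carrier G" "g \<in> carrier G"
  shows "inv g \<otimes> commutator G x y \<otimes> g = commutator G (inv g \<otimes> x \<otimes> g) (inv g \<otimes> y \<otimes> g)"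
proof -
  interpret c: group_hom G G "\<lambda>x. inv g \<otimes> x \<otimes> g"
    using conj_hom assms by unfold_locales auto
  show ?thesis by (rule c.hom_commutator[OF assms(1,2)])
qed

text \<open>Conjugation by \<open>g\<close> multiplies \<open>a\<close> and \<open>b\<close> by
  their commutators with \<open>g\<close>. By \<open>commutator_perturb\<close> these factors do not
  change \<open>commutator G a b\<close>, which is therefore fixed by \<open>g\<close>.\<close>

lemma (in group) commutator_commutator_eq_one:
  assumes car: "a \<in> carrier G" "b \<in> carrier G" "g \<in> carrier G"
    and "commutator G (commutator G a g) b = \<one>"
    and "commutator G (commutator G a g) (commutator G b g) = \<one>"
    and "commutator G a (commutator G b g) = \<one>"
    and "commutator G (commutator G a b) (commutator G a g) = \<one>"
    and "commutator G (commutator G a b) (commutator G b g) = \<one>"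
  shows "commutator G (commutator G a b) g = \<one>"
proof -
  have "inv g \<otimes> commutator G a b \<otimes> g
      = commutator G (a \<otimes> commutator G a g) (b \<otimes> commutator G b g)"
    using conj_commutator[OF car] by (simp only: conj_eq_mult_commutator[OF car(1,3)]
        conj_eq_mult_commutator[OF car(2,3)])
  also have "\<dots> = commutator G a b"
    using assms by (intro commutator_perturb) auto
  finally have "commutator G a b \<otimes> commutator G (commutator G a b) g = commutator G a b"
    using car by (simp add: conj_eq_mult_commutator)
  then show ?thesis using car by simp
qed

lemma (in normal) quotient_hom: "group_hom G (G Mod H) ((#>) H)"
  using r_coset_hom_Mod factorgroup_is_group is_group
  by (simp add: group_hom_def group_hom_axioms_def)

lemma (in normal) coset_eq_one_iff: "x \<in> carrier G \<Longrightarrow> H #> x = \<one>\<^bsub>G Mod H\<^esub> \<longleftrightarrow> x \<in> H"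
  using coset_join1[OF _ _ is_subgroup] coset_join2[OF _ is_subgroup] by auto

lemma (in group) commutator_commutator_mem:
  assumes N: "C \<lhd> G" and car: "a \<in> carrier G" "b \<in> carrier G" "g \<in> carrier G"
    and "commutator G (commutator G a g) b \<in> C"
    and "commutator G (commutator G a g) (commutator G b g) \<in> C"
    and "commutator G a (commutator G b g) \<in> C"
    and "commutator G (commutator G a b) (commutator G a g) \<in> C"
    and "commutator G (commutator G a b) (commutator G b g) \<in> C"
  shows "commutator G (commutator G a b) g \<in> C"
proof -
  interpret C: normal C G by fact
  interpret q: group_hom G "G Mod C" "(#>) C" by (rule C.quotient_hom)
  have *: "commutator (G Mod C) (C #> x) (C #> y) = \<one>\<^bsub>G Mod C\<^esub>"
    if "commutator G x y \<in> C" "x \<in> carrier G" "y \<in> carrier G" for x y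
  proof -
    have "C #> commutator G x y = \<one>\<^bsub>G Mod C\<^esub>"
      using that(1) C.coset_eq_one_iff[OF commutator_closed[OF that(2,3)]] by (rule iffD2[rotated])
    then show ?thesis unfolding q.hom_commutator[OF that(2,3)] .
  qed
  note hom = q.hom_commutator[OF car(1,2)] q.hom_commutator[OF car(1,3)]
    q.hom_commutator[OF car(2,3)]
  have "commutator (G Mod C) (commutator (G Mod C) (C #> a) (C #> b)) (C #> g) = \<one>\<^bsub>G Mod C\<^esub>"
    by (rule q.H.commutator_commutator_eq_one[OF q.hom_closed[OF car(1)] q.hom_closed[OF car(2)]
          q.hom_closed[OF car(3)]]; unfold hom[symmetric]; rule *; (rule assms | intro commutator_closed car))
  then have "C #> commutator G (commutator G a b) g = \<one>\<^bsub>G Mod C\<^esub>"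
    unfolding hom(1)[symmetric] q.hom_commutator[OF commutator_closed[OF car(1,2)] car(3)] .
  then show ?thesis
    using C.coset_eq_one_iff[OF commutator_closed[OF commutator_closed[OF car(1,2)] car(3)]]
    by (rule iffD1[rotated])
qed

section \<open>Commutator subgroups\<close>

definition commutator_subgroup :: "('a, 'b) monoid_scheme \<Rightarrow> 'a set \<Rightarrow> 'a set \<Rightarrow> 'a set" where
  "commutator_subgroup G A B = generate G {commutator G a b | a b. a \<in> A \<and> b \<in> B}"

context group
begin

lemma commutator_subgroup_normal:
  assumes "A \<lhd> G" "B \<lhd> G"
  shows "commutator_subgroup G A B \<lhd> G"
proof -
  interpret A: normal A G by fact
  interpret B: normal B G by fact
  show ?thesis unfolding commutator_subgroup_def
  proof (rule normal_generateI)
    show "{commutator G a b | a b. a \<in> A \<and> b \<in> B} \<subseteq> carrier G" by auto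
    fix h g assume "h \<in> {commutator G a b | a b. a \<in> A \<and> b \<in> B}" and g: "g \<in> carrier G"
    then obtain a b where h: "h = commutator G a b" and ab: "a \<in> A" "b \<in> B" by auto
    have "g \<otimes> h \<otimes> inv g = commutator G (g \<otimes> a \<otimes> inv g) (g \<otimes> b \<otimes> inv g)"
      using conj_commutator[of a b "inv g"] ab g h by simp
    then show "g \<otimes> h \<otimes> inv g \<in> {commutator G a b | a b. a \<in> A \<and> b \<in> B}"
      using ab g A.inv_op_closed2 B.inv_op_closed2 by blast
  qed
qed

lemma commutator_subgroup_mem:
  "a \<in> A \<Longrightarrow> b \<in> B \<Longrightarrow> commutator G a b \<in> commutator_subgroup G A B"
  unfolding commutator_subgroup_def by (auto intro!: generate.incl)

lemma commutator_subgroup_mem_swap: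
  assumes "A \<subseteq> carrier G" "B \<subseteq> carrier G" "a \<in> A" "b \<in> B"
  shows "commutator G b a \<in> commutator_subgroup G A B"
proof -
  have "{commutator G a b | a b. a \<in> A \<and> b \<in> B} \<subseteq> carrier G" using assms by auto
  from generate_m_inv_closed[OF this, of "commutator G a b"]
    commutator_subgroup_mem[OF assms(3,4)]
  have "inv (commutator G a b) \<in> commutator_subgroup G A B"
    by (simp add: commutator_subgroup_def)
  moreover have "inv (commutator G a b) = commutator G b a"
    using assms by (auto intro: inv_commutator)
  ultimately show ?thesis by simp
qed

lemma commutator_subgroup_incl:
  assumes "subgroup N G" "\<And>a b. a \<in> A \<Longrightarrow> b \<in> B \<Longrightarrow> commutator G a b \<in> N"
  shows "commutator_subgroup G A B \<subseteq> N"
  unfolding commutator_subgroup_def by (rule generate_subgroup_incl) (use assms in auto)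

text \<open>The two commutator conventions differ by inverting both arguments, and \<open>A\<close>
  is closed under inverses.\<close>

lemma derived_eq_commutator_subgroup:
  assumes "subgroup A G"
  shows "derived G A = commutator_subgroup G A A"
proof -
  interpret A: subgroup A G by fact
  have "derived_set G A = {commutator G a b | a b. a \<in> A \<and> b \<in> A}"
  proof (intro equalityI subsetI)
    fix x assume "x \<in> derived_set G A"
    then obtain a b where "a \<in> A" "b \<in> A" "x = a \<otimes> b \<otimes> inv a \<otimes> inv b" by auto
    then have "x = commutator G (inv a) (inv b)" "inv a \<in> A" "inv b \<in> A"
      by (auto simp: commutator_def)
    then show "x \<in> {commutator G a b | a b. a \<in> A \<and> b \<in> A}" by blast
  next
    fix x assume "x \<in> {commutator G a b | a b. a \<in> A \<and> b \<in> A}"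
    then obtain a b where ab: "a \<in> A" "b \<in> A" "x = commutator G a b" by auto
    then have "x = inv a \<otimes> inv b \<otimes> inv (inv a) \<otimes> inv (inv b)" by (simp add: commutator_def)
    with ab(1,2) show "x \<in> derived_set G A" by blast
  qed
  then show ?thesis by (simp add: derived_def commutator_subgroup_def)
qed

lemma derived_normal:
  assumes "A \<lhd> G" shows "derived G A \<lhd> G"
  using derived_eq_commutator_subgroup[OF normal_imp_subgroup[OF assms]]
    commutator_subgroup_normal[OF assms assms] by simp

end

section \<open>Nilpotent actions on abelian normal subgroups\<close>

text \<open>Conjugation makes \<open>A\<close> a right module over the integral group ring of
  \<open>G\<close>, here written multiplicatively: \<open>commutator G a g\<close> is the image of
  \<open>a\<close> under g - 1, and \<open>iter_commutator\<close> applies a product of such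
  operators.\<close>

locale abelian_normal = normal A G for A and G (structure) +
  assumes comm: "a \<in> A \<Longrightarrow> b \<in> A \<Longrightarrow> a \<otimes> b = b \<otimes> a"
begin

lemma left_comm: "a \<in> A \<Longrightarrow> b \<in> A \<Longrightarrow> c \<in> A \<Longrightarrow> a \<otimes> (b \<otimes> c) = b \<otimes> (a \<otimes> c)"
  using comm[of a b] by (simp flip: m_assoc)

lemma commutator_mem [simp, intro]:
  "a \<in> A \<Longrightarrow> g \<in> carrier G \<Longrightarrow> commutator G a g \<in> A"
  by (rule commutator_mem_normal(1)[OF normal_axioms])

lemma iter_commutator_mem [simp, intro]:
  "a \<in> A \<Longrightarrow> set gs \<subseteq> carrier G \<Longrightarrow> iter_commutator G a gs \<in> A"
  by (rule iter_commutator_mem_normal[OF normal_axioms])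

lemma commutator_mult:
  assumes "a \<in> A" "b \<in> A" "g \<in> carrier G"
  shows "commutator G (a \<otimes> b) g = commutator G a g \<otimes> commutator G b g"
proof -
  have "inv b \<otimes> commutator G a g \<otimes> b = commutator G a g"
    using assms comm[of "commutator G a g" b] by (simp add: m_assoc)
  then show ?thesis using assms by (simp add: commutator_mult_left)
qed

lemma commutator_inv:
  assumes "a \<in> A" "g \<in> carrier G"
  shows "commutator G (inv a) g = inv (commutator G a g)"
  using assms commutator_mult[of "inv a" a g] by (intro inv_equality[symmetric]) auto

lemma iter_commutator_mult:
  "a \<in> A \<Longrightarrow> b \<in> A \<Longrightarrow> set gs \<subseteq> carrier G \<Longrightarrow>
    iter_commutator G (a \<otimes> b) gs = iter_commutator G a gs \<otimes> iter_commutator G b gs"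
  by (induction gs arbitrary: a b) (auto simp: commutator_mult)

lemma iter_commutator_inv:
  "a \<in> A \<Longrightarrow> set gs \<subseteq> carrier G \<Longrightarrow>
    iter_commutator G (inv a) gs = inv (iter_commutator G a gs)"
  by (induction gs arbitrary: a) (auto simp: commutator_inv)

text \<open>In the group ring this is gh - 1 = (h - 1) + (g - 1) + (g - 1)(h - 1).\<close>

lemma commutator_mult_right':
  assumes "a \<in> A" "g \<in> carrier G" "h \<in> carrier G"
  shows "commutator G a (g \<otimes> h)
    = commutator G a h \<otimes> (commutator G a g \<otimes> commutator G (commutator G a g) h)"
  using assms by (simp add: commutator_mult_right conj_eq_mult_commutator)

text \<open>Solves g g^-1 - 1 = 0 for g^-1 - 1. On the right \<open>inv g\<close> acts only on
  \<open>commutator G a g\<close>, which is harmless once that element lies in an invariant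
  subgroup.\<close>

lemma commutator_inv_right:
  assumes "a \<in> A" "g \<in> carrier G"
  shows "commutator G a (inv g)
    = inv (commutator G a g \<otimes> commutator G (commutator G a g) (inv g))"
proof (rule inv_equality[symmetric])
  show "commutator G a (inv g) \<otimes> (commutator G a g \<otimes> commutator G (commutator G a g) (inv g)) = \<one>"
    using assms commutator_mult_right'[of a g "inv g"] by simp
qed (use assms in auto)

text \<open>The elements killed by all products of \<open>j\<close> factors g - 1 with
  \<open>g\<close> in \<open>S\<close>. For \<open>S\<close> the whole group,
  \<open>annih S j = A\<close> says that the j-th power of the augmentation ideal annihilates
  \<open>A\<close>.\<close>

definition annih :: "'a set \<Rightarrow> nat \<Rightarrow> 'a set" where
  "annih S j = {a \<in> A. \<forall>gs. set gs \<subseteq> S \<and> length gs = j \<longrightarrow> iter_commutator G a gs = \<one>}"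

lemma annihD: "a \<in> annih S j \<Longrightarrow> set gs \<subseteq> S \<Longrightarrow> length gs = j \<Longrightarrow> iter_commutator G a gs = \<one>"
  by (simp add: annih_def)

lemma annih_0 [simp]: "annih S 0 = {\<one>}"
  by (auto simp: annih_def)

lemma annih_Suc:
  assumes "S \<subseteq> carrier G"
  shows "annih S (Suc j) = {a \<in> A. \<forall>g\<in>S. commutator G a g \<in> annih S j}"
proof (intro equalityI subsetI)
  fix a assume a: "a \<in> annih S (Suc j)"
  have "iter_commutator G (commutator G a g) gs = \<one>"
    if "g \<in> S" "set gs \<subseteq> S" "length gs = j" for g gs
    using annihD[OF a, of "g # gs"] that by simp
  with a show "a \<in> {a \<in> A. \<forall>g\<in>S. commutator G a g \<in> annih S j}"
    using assms by (auto simp: annih_def)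
qed (auto simp: annih_def length_Suc_conv)

lemma subgroup_annih:
  assumes "S \<subseteq> carrier G" shows "subgroup (annih S j) G"
proof (rule subgroupI)
  have "\<one> \<in> annih S j" using assms by (auto simp: annih_def)
  then show "annih S j \<noteq> {}" by blast
qed (use assms in \<open>auto simp: annih_def iter_commutator_mult iter_commutator_inv\<close>)

text \<open>The first \<open>j\<close> letters of the word \<open>g # gs\<close> already kill
  \<open>a\<close>, so its last letter acts on the neutral element.\<close>

lemma annih_invariant:
  assumes "S \<subseteq> carrier G" "a \<in> annih S j" "g \<in> S"
  shows "commutator G a g \<in> annih S j"
proof -
  have "iter_commutator G (commutator G a g) gs = \<one>" if gs: "set gs \<subseteq> S" "length gs = j" for gs
  proof -
    obtain hs x where hs: "g # gs = hs @ [x]" by (metis append_butlast_last_id list.discI)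
    have "set (hs @ [x]) \<subseteq> S" "length (hs @ [x]) = Suc j"
      unfolding hs[symmetric] using gs assms(3) by auto
    then have "set hs \<subseteq> S" "x \<in> S" "length hs = j" by auto
    then have "iter_commutator G a (g # gs) = \<one>"
      unfolding hs using assms by (auto simp: annih_def iter_commutator_append)
    then show ?thesis by simp
  qed
  then show ?thesis using assms by (auto simp: annih_def)
qed

text \<open>The annihilators form an ascending chain in which each term is invariant, so that the elements
  moving a fixed \<open>a\<close> of one term into the preceding one form a subgroup.\<close>

lemma annih_generate:
  assumes "S \<subseteq> carrier G"
  shows "annih (generate G S) j = annih S j"
proof (induction j)
  case (Suc j)
  let ?P = "generate G S"
  have P: "?P \<subseteq> carrier G" using assms by (rule generate_incl)
  interpret K: subgroup "annih ?P j" G by (rule subgroup_annih[OF P])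
  have "commutator G a g \<in> annih ?P j" if a: "a \<in> annih S (Suc j)" and g: "g \<in> ?P" for a g
  proof -
    have aA: "a \<in> A" using a by (simp add: annih_def)
    have "subgroup {g \<in> ?P. commutator G a g \<in> annih ?P j} G"
    proof (rule subgroupI)
      have "\<one> \<in> ?P" by (rule generate.one)
      then show "{g \<in> ?P. commutator G a g \<in> annih ?P j} \<noteq> {}" using aA by auto
      fix x assume x: "x \<in> {g \<in> ?P. commutator G a g \<in> annih ?P j}"
      then have xP: "x \<in> ?P" "inv x \<in> ?P" using generate_m_inv_closed[OF assms] by auto
      moreover have "commutator G (commutator G a x) (inv x) \<in> annih ?P j"
        by (rule annih_invariant[OF P]) (use x xP in auto)
      ultimately show "inv x \<in> {g \<in> ?P. commutator G a g \<in> annih ?P j}"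
        using x P commutator_inv_right[OF aA, of x] by auto
      fix y assume y: "y \<in> {g \<in> ?P. commutator G a g \<in> annih ?P j}"
      then have "x \<otimes> y \<in> ?P" using xP by (auto intro: generate.eng)
      moreover have "commutator G (commutator G a x) y \<in> annih ?P j"
        by (rule annih_invariant[OF P]) (use x y in auto)
      ultimately show "x \<otimes> y \<in> {g \<in> ?P. commutator G a g \<in> annih ?P j}"
        using x y P commutator_mult_right'[OF aA, of x y] K.m_closed by (simp add: subset_iff)
    qed (use P in auto)
    moreover have "S \<subseteq> {g \<in> ?P. commutator G a g \<in> annih ?P j}"
      using a assms Suc.IH by (auto simp: annih_Suc intro: generate.incl)
    ultimately show ?thesis using g generate_subgroup_incl by blast
  qed
  then have "annih S (Suc j) \<subseteq> annih ?P (Suc j)"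
    by (auto simp: annih_Suc[OF P]) (auto simp: annih_def)
  moreover have "annih ?P (Suc j) \<subseteq> annih S (Suc j)"
    using generate.incl[of _ S G] by (force simp: annih_def)
  ultimately show ?case by blast
qed simp

section \<open>Rearranging iterated commutators up to sign\<close>

abbreviation eq_or_inv :: "'a \<Rightarrow> 'a \<Rightarrow> bool" where
  "eq_or_inv a b \<equiv> b = a \<or> b = inv a"

text \<open>The letter \<open>x\<close> passes the letters of \<open>gs\<close> one by one. An
  inversion picked up on the way survives the remaining commutations, since these respect inverses
  on \<open>A\<close>.\<close>

lemma iter_commutator_move_front:
  assumes S: "S \<subseteq> carrier G"
    and swap: "\<And>a x y. a \<in> A \<Longrightarrow> x \<in> S \<Longrightarrow> y \<in> S \<Longrightarrow>
      eq_or_inv (commutator G (commutator G a x) y) (commutator G (commutator G a y) x)"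
    and x: "x \<in> S" and gs: "set gs \<subseteq> S" and a: "a \<in> A"
  shows "eq_or_inv (iter_commutator G a (gs @ [x])) (iter_commutator G a (x # gs))"
  using gs a
proof (induction gs arbitrary: a)
  case (Cons y gs)
  have "iter_commutator G (commutator G (commutator G a x) y) gs
      = iter_commutator G (commutator G (commutator G a y) x) gs \<or>
    iter_commutator G (commutator G (commutator G a x) y) gs
      = inv (iter_commutator G (commutator G (commutator G a y) x) gs)"
  proof -
    have "set gs \<subseteq> carrier G" "commutator G (commutator G a y) x \<in> A"
      using Cons.prems x S by (auto intro!: commutator_mem)
    then show ?thesis
      using Cons.prems swap[of a y x] x by (auto simp: iter_commutator_inv)
  qed
  moreover have "eq_or_inv (iter_commutator G (commutator G a y) (gs @ [x]))
      (iter_commutator G (commutator G a y) (x # gs))"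
    using Cons.prems S by (intro Cons.IH) auto
  moreover have "iter_commutator G (commutator G (commutator G a y) x) gs \<in> carrier G"
    "iter_commutator G (commutator G a y) (gs @ [x]) \<in> carrier G"
  proof -
    have "set gs \<subseteq> carrier G" "x \<in> carrier G" "commutator G a y \<in> A"
      using Cons.prems x S by (auto intro!: commutator_mem)
    then show "iter_commutator G (commutator G (commutator G a y) x) gs \<in> carrier G"
      "iter_commutator G (commutator G a y) (gs @ [x]) \<in> carrier G"
      by (auto intro!: iter_commutator_closed)
  qed
  ultimately show ?case by auto
qed simp

text \<open>Induction on the last letter: an \<open>x\<close> is moved in front of the filtered
  letters, where it lengthens the block of \<open>x\<close>; any other letter stays in
  place.\<close>

lemma iter_commutator_collect:
  assumes S: "S \<subseteq> carrier G"
    and swap: "\<And>a x y. a \<in> A \<Longrightarrow> x \<in> S \<Longrightarrow> y \<in> S \<Longrightarrow>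
      eq_or_inv (commutator G (commutator G a x) y) (commutator G (commutator G a y) x)"
    and x: "x \<in> S" and gs: "set gs \<subseteq> S" and a: "a \<in> A"
  shows "eq_or_inv (iter_commutator G a gs)
    (iter_commutator G a (replicate (count_list gs x) x @ filter (\<lambda>y. y \<noteq> x) gs))"
  using gs
proof (induction gs rule: rev_induct)
  case (snoc y gs)
  let ?f = "filter (\<lambda>y. y \<noteq> x) gs" and ?r = "replicate (count_list gs x) x"
  have f: "set ?f \<subseteq> S" "set ?f \<subseteq> carrier G" "set ?r \<subseteq> S" "set ?r \<subseteq> carrier G"
    using snoc.prems S x by auto
  have y: "y \<in> S" "y \<in> carrier G" using snoc.prems S by auto
  have mem: "iter_commutator G a gs \<in> A" "iter_commutator G a ?r \<in> A"
    using snoc.prems a S f by auto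
  have IH: "eq_or_inv (iter_commutator G a (gs @ [y])) (iter_commutator G a (?r @ ?f @ [y]))"
  proof -
    have "eq_or_inv (iter_commutator G a gs) (iter_commutator G a (?r @ ?f))"
      using snoc by simp
    moreover have "iter_commutator G a (hs @ [y]) = commutator G (iter_commutator G a hs) y" for hs
      by (simp add: iter_commutator_append)
    from this[of gs] this[of "?r @ ?f"] commutator_inv[OF mem(1) y(2)]
    have "iter_commutator G a (gs @ [y]) = commutator G (iter_commutator G a gs) y"
      "iter_commutator G a (?r @ ?f @ [y]) = commutator G (iter_commutator G a (?r @ ?f)) y"
      "commutator G (inv (iter_commutator G a gs)) y = inv (commutator G (iter_commutator G a gs) y)"
      by simp_all
    ultimately show ?thesis by metis
  qed
  show ?case
  proof (cases "y = x")
    case True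
    have "eq_or_inv (iter_commutator G (iter_commutator G a ?r) (?f @ [x]))
        (iter_commutator G (iter_commutator G a ?r) (x # ?f))"
      by (rule iter_commutator_move_front[OF S swap x f(1) mem(2)])
    then have "eq_or_inv (iter_commutator G a (?r @ ?f @ [x])) (iter_commutator G a ((?r @ [x]) @ ?f))"
      by (simp only: iter_commutator_append iter_commutator_Cons iter_commutator_Nil)
    moreover have "(?r @ [x]) @ ?f
        = replicate (count_list (gs @ [y]) x) x @ filter (\<lambda>y. y \<noteq> x) (gs @ [y])"
      using True by (simp add: replicate_append_same)
    moreover have "set (gs @ [y]) \<subseteq> carrier G" using snoc.prems S by auto
    then have "iter_commutator G a (gs @ [y]) \<in> carrier G"
      by (rule iter_commutator_closed[OF mem_carrier[OF a]])
    ultimately show ?thesis using IH True by (metis inv_inv)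
  next
    case False
    then have "replicate (count_list (gs @ [y]) x) x @ filter (\<lambda>y. y \<noteq> x) (gs @ [y]) = ?r @ ?f @ [y]"
      by simp
    with IH show ?thesis by metis
  qed
qed simp

text \<open>A long word over \<open>S\<close> repeats some letter \<open>k\<close> times; collected
  at the front, these repetitions kill the word by \<open>nil\<close>. Then
  \<open>annih_generate\<close> passes from \<open>S\<close> to the group it generates.\<close>

lemma annih_generate_eq:
  assumes S: "finite S" "S \<subseteq> carrier G"
    and swap: "\<And>a x y. a \<in> A \<Longrightarrow> x \<in> S \<Longrightarrow> y \<in> S \<Longrightarrow>
      eq_or_inv (commutator G (commutator G a x) y) (commutator G (commutator G a y) x)"
    and nil: "\<And>a x. a \<in> A \<Longrightarrow> x \<in> S \<Longrightarrow> iter_commutator G a (replicate k x) = \<one>"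
  shows "annih (generate G S) (Suc (card S * k)) = A"
proof -
  have "iter_commutator G a gs = \<one>"
    if a: "a \<in> A" and gs: "set gs \<subseteq> S" "length gs = Suc (card S * k)" for a gs
  proof -
    \<comment> \<open>Pigeonhole: otherwise the length is at most \<open>card S * k\<close>. The
      extra letter also covers an empty \<open>S\<close>, over which only the empty word
      exists.\<close>
    have "\<exists>x\<in>S. k \<le> count_list gs x"
    proof (rule ccontr)
      assume "\<not> ?thesis"
      then have "sum (count_list gs) S \<le> card S * k"
        using sum_bounded_above[of S "count_list gs" k] by (auto simp: not_le intro: less_imp_le)
      with sum_count_set[OF gs(1) S(1)] gs(2) show False by simp
    qed
    then obtain x j where x: "x \<in> S" "count_list gs x = k + j" by (auto simp: le_iff_add)
    have gsG: "set gs \<subseteq> carrier G" "x \<in> carrier G" using gs S x by auto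
    have r: "set (replicate j x) \<subseteq> carrier G" using gsG by auto
    have "iter_commutator G a (replicate (k + j) x @ filter (\<lambda>y. y \<noteq> x) gs) = \<one>"
      using gsG x r by (auto simp: replicate_add iter_commutator_append nil[OF a] intro!: iter_commutator_one)
    moreover have "iter_commutator G a gs \<in> carrier G"
      by (rule iter_commutator_closed[OF mem_carrier[OF a] gsG(1)])
    ultimately show ?thesis
      using iter_commutator_collect[OF S(2) swap x(1) gs(1) a] x(2) by (metis inv_eq_1_iff)
  qed
  then have "annih S (Suc (card S * k)) = A" by (auto simp: annih_def)
  then show ?thesis using annih_generate[OF S(2)] by simp
qed

text \<open>For \<open>g - 1 = x\<close> and \<open>h - 1 = y\<close> one has \<open>gh - 1 = x + y + xy\<close>, and \<open>x\<^sup>2 = y\<^sup>2 = (x + y + xy)\<^sup>2 = 0\<close>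
  forces \<open>xyxy = 0\<close>, then \<open>xyx = yxy = 0\<close> and \<open>xy + yx = 0\<close>.\<close>

lemma square_zero_anticommute:
  assumes g: "g \<in> carrier G" and h: "h \<in> carrier G" and a: "a \<in> A"
    and gg: "\<And>a. a \<in> A \<Longrightarrow> commutator G (commutator G a g) g = \<one>"
    and hh: "\<And>a. a \<in> A \<Longrightarrow> commutator G (commutator G a h) h = \<one>"
    and gh: "\<And>a. a \<in> A \<Longrightarrow> commutator G (commutator G a (g \<otimes> h)) (g \<otimes> h) = \<one>"
  shows "commutator G (commutator G a g) h = inv (commutator G (commutator G a h) g)"
proof -
  define x where "x a = commutator G a g" for a
  define y where "y a = commutator G a h" for a
  have xA [simp]: "x a \<in> A" "x a \<in> carrier G" "y a \<in> A" "y a \<in> carrier G" if "a \<in> A" for a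
    using that g h by (auto simp: x_def y_def)
  have xm [simp]: "x (a \<otimes> b) = x a \<otimes> x b" "y (a \<otimes> b) = y a \<otimes> y b" if "a \<in> A" "b \<in> A" for a b
    using that g h by (simp_all add: x_def y_def commutator_mult)
  have xx [simp]: "x (x a) = \<one>" "y (y a) = \<one>" if "a \<in> A" for a
    using that gg hh by (simp_all add: x_def y_def)
  have one [simp]: "x \<one> = \<one>" "y \<one> = \<one>" using g h by (simp_all add: x_def y_def)
  have xy: "commutator G a (g \<otimes> h) = y a \<otimes> (x a \<otimes> y (x a))" if "a \<in> A" for a
    using that g h by (simp add: commutator_mult_right' x_def y_def)
  \<comment> \<open>Here \<open>y (x a)\<close> is the image of \<open>a\<close> under the product
    xy. The factors are the five terms of (x + y + xy)^2 that survive x^2 = y^2 = 0.\<close>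
  have E: "x (y a) \<otimes> (y (x (y a)) \<otimes> (y (x a) \<otimes> (x (y (x a)) \<otimes> y (x (y (x a)))))) = \<one>"
    if "a \<in> A" for a
    using gh[OF that] that by (simp add: xy m_assoc comm left_comm)
  \<comment> \<open>Replacing \<open>a\<close> by \<open>x a\<close> multiplies the relation by x on
    the left and leaves xyx + xyxy = 0; applying \<open>y\<close> then isolates xyxy.\<close>
  have 1: "x (y (x a)) \<otimes> y (x (y (x a))) = \<one>" if "a \<in> A" for a
    using E[of "x a"] that by simp
  have 2: "y (x (y (x a))) = \<one>" if "a \<in> A" for a
    using arg_cong[OF 1[OF that], of y] that by simp
  have 3: "x (y (x a)) = \<one>" if "a \<in> A" for a
    using 1[OF that] 2[OF that] that by simp
  have 4: "x (y a) \<otimes> (y (x (y a)) \<otimes> y (x a)) = \<one>"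
    using E[OF a] 2[OF a] 3[OF a] a by simp
  have 5: "y (x (y a)) = \<one>" using arg_cong[OF 4, of y] a by simp
  have "y (x a) \<otimes> x (y a) = \<one>" using 4 5 a comm[of "y (x a)" "x (y a)"] by simp
  then have "y (x a) = inv (x (y a))" using a by (intro inv_equality[symmetric]) auto
  then show ?thesis by (simp add: x_def y_def)
qed

end

section \<open>Two commuting copies of a group\<close>

text \<open>Collects what is used about XX(G): \<open>H\<close> stands for \<open>XX G\<close>, with
  \<open>i\<close> and \<open>j\<close> its two copies of \<open>G\<close>. The universal property
  enters only through the projections.\<close>

locale weak_commutativity = H: group H + G: group G +
  i: group_hom G H i + j: group_hom G H j +
  p1: group_hom H G p1 + p2: group_hom H G p2 + p3: group_hom H G p3
  for H (structure) and G and i j p1 p2 p3 +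
  assumes gen: "generate H (i ` carrier G \<union> j ` carrier G) = carrier H"
    and ij: "g \<in> carrier G \<Longrightarrow> i g \<otimes> j g = j g \<otimes> i g"
    and p_i [simp]: "g \<in> carrier G \<Longrightarrow> p1 (i g) = g" "g \<in> carrier G \<Longrightarrow> p2 (i g) = g"
      "g \<in> carrier G \<Longrightarrow> p3 (i g) = \<one>\<^bsub>G\<^esub>"
    and p_j [simp]: "g \<in> carrier G \<Longrightarrow> p1 (j g) = \<one>\<^bsub>G\<^esub>" "g \<in> carrier G \<Longrightarrow> p2 (j g) = g"
      "g \<in> carrier G \<Longrightarrow> p3 (j g) = g"
begin

definition L where "L = kernel H G p2"
definition M1 where "M1 = L \<inter> kernel H G p1"
definition M3 where "M3 = L \<inter> kernel H G p3"
definition W where "W = M3 \<inter> M1"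

lemma mem_L: "x \<in> L \<longleftrightarrow> x \<in> carrier H \<and> p2 x = \<one>\<^bsub>G\<^esub>"
  and mem_M1: "x \<in> M1 \<longleftrightarrow> x \<in> carrier H \<and> p2 x = \<one>\<^bsub>G\<^esub> \<and> p1 x = \<one>\<^bsub>G\<^esub>"
  and mem_M3: "x \<in> M3 \<longleftrightarrow> x \<in> carrier H \<and> p2 x = \<one>\<^bsub>G\<^esub> \<and> p3 x = \<one>\<^bsub>G\<^esub>"
  and mem_W: "x \<in> W \<longleftrightarrow> x \<in> carrier H \<and> p1 x = \<one>\<^bsub>G\<^esub> \<and> p2 x = \<one>\<^bsub>G\<^esub> \<and> p3 x = \<one>\<^bsub>G\<^esub>"
  by (auto simp: L_def M1_def M3_def W_def kernel_def)

lemma normal_L: "L \<lhd> H" and normal_M1: "M1 \<lhd> H" and normal_M3: "M3 \<lhd> H" and normal_W: "W \<lhd> H"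
  unfolding W_def M1_def M3_def L_def
  by (intro H.normal_subgroup_intersect p1.normal_kernel p2.normal_kernel p3.normal_kernel)+

lemmas mems = mem_L mem_M1 mem_M3 mem_W

text \<open>A derivation from \<open>G\<close> to \<open>L\<close>, in the sense of
  \<open>delta_mult\<close>, that measures the difference between the two copies.\<close>

definition delta :: "'c \<Rightarrow> 'a" where "delta g = inv (i g) \<otimes> j g"

lemma delta_closed [simp]: "g \<in> carrier G \<Longrightarrow> delta g \<in> carrier H"
  by (simp add: delta_def)

text \<open>The two copies of g h^-1 commute. Inserted into one commutator, this relation together
  with those for \<open>g\<close> and \<open>h\<close> yields the other.\<close>

lemma commutator_swap:
  assumes "g \<in> carrier G" "h \<in> carrier G"
  shows "commutator H (i g) (j h) = commutator H (j g) (i h)"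
proof -
  define a a' b b' where "a = i g" and "a' = j g" and "b = i h" and "b' = j h"
  have [simp]: "a \<in> carrier H" "a' \<in> carrier H" "b \<in> carrier H" "b' \<in> carrier H"
    using assms by (simp_all add: a_def a'_def b_def b'_def)
  have aa: "a \<otimes> a' = a' \<otimes> a" and bb: "b \<otimes> b' = b' \<otimes> b"
    using assms ij by (simp_all add: a_def a'_def b_def b'_def)
  have R: "a \<otimes> inv b \<otimes> (a' \<otimes> inv b') = a' \<otimes> inv b' \<otimes> (a \<otimes> inv b)"
    using ij[of "g \<otimes>\<^bsub>G\<^esub> inv\<^bsub>G\<^esub> h"] assms by (simp add: a_def a'_def b_def b'_def)
  have "commutator H a' b = inv a' \<otimes> inv a \<otimes> (a \<otimes> inv b \<otimes> (a' \<otimes> inv b')) \<otimes> (b' \<otimes> b)"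
    by (simp add: commutator_def H.m_assoc)
  also have "\<dots> = inv (a \<otimes> a') \<otimes> (a' \<otimes> inv b' \<otimes> (a \<otimes> inv b)) \<otimes> (b \<otimes> b')"
    by (simp only: R bb) (simp add: H.inv_mult_group)
  also have "\<dots> = commutator H a b'"
    unfolding aa by (simp add: commutator_def H.m_assoc H.inv_mult_group)
  finally show ?thesis by (simp add: a_def a'_def b_def b'_def)
qed

text \<open>Expanding \<open>commutator_swap\<close> for \<open>g\<close> and the product of
  \<open>h\<close> and \<open>k\<close> shows that \<open>j k\<close> and \<open>i k\<close>
  conjugate the commutator in the same way; hence it commutes with their quotient
  \<open>delta k\<close>.\<close>

lemma commutator_i_j_delta:
  assumes [simp]: "g \<in> carrier G" "h \<in> carrier G" "k \<in> carrier G"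
  shows "commutator H (delta k) (commutator H (i g) (j h)) = \<one>"
proof -
  define c where "c = commutator H (i g) (j h)"
  have [simp]: "c \<in> carrier H" by (simp add: c_def)
  have "commutator H (i g) (j k) \<otimes> (inv (j k) \<otimes> c \<otimes> j k)
      = commutator H (i g) (j (h \<otimes>\<^bsub>G\<^esub> k))"
    by (simp add: c_def H.commutator_mult_right)
  also have "\<dots> = commutator H (j g) (i (h \<otimes>\<^bsub>G\<^esub> k))"
    by (rule commutator_swap) simp_all
  also have "\<dots> = commutator H (i g) (j k) \<otimes> (inv (i k) \<otimes> c \<otimes> i k)"
    by (simp add: c_def H.commutator_mult_right commutator_swap)
  finally have *: "inv (j k) \<otimes> c \<otimes> j k = inv (i k) \<otimes> c \<otimes> i k" by simp
  have d: "delta k = j k \<otimes> inv (i k)"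
  proof -
    have "delta k = inv (i k) \<otimes> (j k \<otimes> i k) \<otimes> inv (i k)"
      by (simp add: delta_def H.m_assoc)
    also have "\<dots> = j k \<otimes> inv (i k)" by (simp add: ij[symmetric] H.m_assoc)
    finally show ?thesis .
  qed
  have "delta k \<otimes> c = j k \<otimes> (inv (i k) \<otimes> c \<otimes> i k) \<otimes> inv (i k)"
    by (simp add: d H.m_assoc)
  also have "\<dots> = c \<otimes> delta k"
    unfolding *[symmetric] by (simp add: d H.m_assoc)
  finally show ?thesis by (simp add: H.commutator_eq_one_iff c_def[symmetric])
qed

lemma conj_delta:
  assumes "g \<in> carrier G" "h \<in> carrier G"
  shows "inv (i h) \<otimes> delta g \<otimes> i h = delta (g \<otimes>\<^bsub>G\<^esub> h) \<otimes> inv (delta h)"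
  using assms by (simp add: delta_def H.m_assoc H.inv_mult_group)

lemma carrier_induct:
  assumes "subgroup P H" "\<And>g. g \<in> carrier G \<Longrightarrow> i g \<in> P" "\<And>g. g \<in> carrier G \<Longrightarrow> j g \<in> P"
    and "x \<in> carrier H"
  shows "x \<in> P"
  using H.generate_subgroup_incl[of "i ` carrier G \<union> j ` carrier G" P] assms gen by auto

text \<open>Every \<open>x\<close> is \<open>i (p2 x)\<close> times an element of the generated
  subgroup: this holds for both copies of \<open>G\<close>, and it passes to products because
  \<open>conj_delta\<close> makes that subgroup invariant under each \<open>i h\<close>. On
  \<open>L\<close> the first factor is trivial.\<close>

lemma L_eq_generate: "L = generate H (delta ` carrier G)"
proof
  let ?E = "generate H (delta ` carrier G)"
  have D: "delta ` carrier G \<subseteq> carrier H" by auto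
  interpret E: subgroup ?E H by (rule H.generate_is_subgroup[OF D])
  have deltaE: "delta g \<in> ?E" if "g \<in> carrier G" for g
    using that by (auto intro: generate.incl)
  have conj: "inv (i h) \<otimes> e \<otimes> i h \<in> ?E" if h: "h \<in> carrier G" and e: "e \<in> ?E" for e h
  proof -
    interpret c: group_hom H H "\<lambda>x. inv (i h) \<otimes> x \<otimes> i h"
      using H.conj_hom[of "i h"] h by unfold_locales auto
    have "(\<lambda>x. inv (i h) \<otimes> x \<otimes> i h) ` ?E \<subseteq> ?E"
      unfolding c.generate_img[OF D, symmetric] using h deltaE
      by (intro H.generate_subgroup_incl E.is_subgroup) (auto simp: conj_delta)
    with e show ?thesis by blast
  qed
  have "subgroup {x \<in> carrier H. inv (i (p2 x)) \<otimes> x \<in> ?E} H"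
  proof (rule H.subgroupI)
    show "{x \<in> carrier H. inv (i (p2 x)) \<otimes> x \<in> ?E} \<noteq> {}"
      by (auto intro!: exI[of _ \<one>])
    fix x assume x: "x \<in> {x \<in> carrier H. inv (i (p2 x)) \<otimes> x \<in> ?E}"
    have "inv (i (inv\<^bsub>G\<^esub> p2 x)) \<otimes> inv (inv (i (p2 x)) \<otimes> x) \<otimes> i (inv\<^bsub>G\<^esub> p2 x) \<in> ?E"
      using x by (intro conj) auto
    moreover have "inv (i (inv\<^bsub>G\<^esub> p2 x)) \<otimes> inv (inv (i (p2 x)) \<otimes> x) \<otimes> i (inv\<^bsub>G\<^esub> p2 x)
        = inv (i (p2 (inv x))) \<otimes> inv x"
      using x by (simp add: H.m_assoc H.inv_mult_group)
    ultimately show "inv x \<in> {x \<in> carrier H. inv (i (p2 x)) \<otimes> x \<in> ?E}" using x by simp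
    fix y assume y: "y \<in> {x \<in> carrier H. inv (i (p2 x)) \<otimes> x \<in> ?E}"
    have "inv (i (p2 y)) \<otimes> (inv (i (p2 x)) \<otimes> x) \<otimes> i (p2 y) \<otimes> (inv (i (p2 y)) \<otimes> y) \<in> ?E"
      by (rule E.m_closed[OF conj]) (use x y in auto)
    then show "x \<otimes> y \<in> {x \<in> carrier H. inv (i (p2 x)) \<otimes> x \<in> ?E}"
      using x y by (simp add: H.m_assoc H.inv_mult_group)
  qed auto
  then have *: "x \<in> {x \<in> carrier H. inv (i (p2 x)) \<otimes> x \<in> ?E}" if "x \<in> carrier H" for x
    by (rule carrier_induct) (use that deltaE in \<open>auto simp: delta_def[symmetric]\<close>)
  show "L \<subseteq> ?E" using * by (force simp: mem_L)
  show "?E \<subseteq> L"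
    by (rule H.generate_subgroup_incl[OF _ normal_imp_subgroup[OF normal_L]]) (auto simp: mem_L delta_def)
qed

lemma commutator_L_eq_one:
  assumes "c \<in> carrier H" "\<And>g. g \<in> carrier G \<Longrightarrow> commutator H (delta g) c = \<one>" "l \<in> L"
  shows "commutator H l c = \<one>"
proof -
  have "commutator H l c \<in> {\<one>}"
  proof (rule H.commutator_mem_generate[OF H.one_is_normal assms(1)])
    show "l \<in> generate H (delta ` carrier G)" using assms(3) L_eq_generate by blast
    fix t assume "t \<in> delta ` carrier G"
    then obtain g where "g \<in> carrier G" "t = delta g" by blast
    then show "commutator H t c \<in> {\<one>}" using assms(2)[of g] by simp
  qed auto
  then show ?thesis by simp
qed

text \<open>Modulo the elements of \<open>ker p1 \<inter> ker p3\<close> that centralize \<open>L\<close> the two copies commute, so every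
  \<open>x\<close> is \<open>i (p1 x) \<otimes> j (p3 x)\<close> times such an element.\<close>

lemma commutator_L_kernels:
  assumes x: "x \<in> carrier H" "p1 x = \<one>\<^bsub>G\<^esub>" "p3 x = \<one>\<^bsub>G\<^esub>" and l: "l \<in> L"
  shows "commutator H l x = \<one>"
proof -
  define C where "C = {x \<in> carrier H. p1 x = \<one>\<^bsub>G\<^esub> \<and> p3 x = \<one>\<^bsub>G\<^esub> \<and> (\<forall>l\<in>L. x \<otimes> l = l \<otimes> x)}"
  interpret L: normal L H by (rule normal_L)
  have "C \<lhd> H"
    unfolding H.normal_inv_iff
  proof (intro conjI ballI H.subgroupI)
    show "C \<noteq> {}" by (auto simp: C_def intro!: exI[of _ \<one>])
    fix x assume x: "x \<in> C"
    then have xX: "x \<in> carrier H" by (simp add: C_def)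
    have "inv x \<otimes> l = l \<otimes> inv x" if "l \<in> L" for l
    proof -
      have "inv x \<otimes> l = inv x \<otimes> (l \<otimes> x) \<otimes> inv x"
        using that xX by (simp add: H.m_assoc)
      also have "\<dots> = inv x \<otimes> (x \<otimes> l) \<otimes> inv x" using x that by (simp add: C_def)
      finally show ?thesis using that xX by (simp add: H.m_assoc)
    qed
    with x show "inv x \<in> C" by (simp add: C_def)
    fix y assume y: "y \<in> C"
    have "x \<otimes> y \<otimes> l = l \<otimes> (x \<otimes> y)" if "l \<in> L" for l
    proof -
      have xyl: "x \<in> carrier H" "y \<in> carrier H" "l \<in> carrier H" "x \<otimes> l = l \<otimes> x" "y \<otimes> l = l \<otimes> y"
        using x y that by (auto simp: C_def)
      have "x \<otimes> y \<otimes> l = x \<otimes> l \<otimes> y" using xyl(1-3,5) by (simp add: H.m_assoc)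
      also have "\<dots> = l \<otimes> (x \<otimes> y)" by (subst xyl(4)) (use xyl(1-3) in \<open>simp add: H.m_assoc\<close>)
      finally show ?thesis .
    qed
    with x y show "x \<otimes> y \<in> C" by (simp add: C_def)
  next
    fix z x assume z: "z \<in> carrier H" and x: "x \<in> C"
    then have xX: "x \<in> carrier H" by (simp add: C_def)
    have "z \<otimes> x \<otimes> inv z \<otimes> l = l \<otimes> (z \<otimes> x \<otimes> inv z)" if l: "l \<in> L" for l
    proof -
      have l': "inv z \<otimes> l \<otimes> z \<in> L" using z l by (rule L.inv_op_closed1)
      have "z \<otimes> x \<otimes> inv z \<otimes> l = z \<otimes> (x \<otimes> (inv z \<otimes> l \<otimes> z)) \<otimes> inv z"
        using z xX l by (simp add: H.m_assoc)
      also have "\<dots> = z \<otimes> ((inv z \<otimes> l \<otimes> z) \<otimes> x) \<otimes> inv z" using x l' by (simp add: C_def)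
      finally show ?thesis using z xX l by (simp add: H.m_assoc)
    qed
    with z x show "z \<otimes> x \<otimes> inv z \<in> C" by (simp add: C_def)
  qed (auto simp: C_def)
  then interpret C: normal C H .
  interpret q: group_hom H "H Mod C" "(#>) C" by (rule C.quotient_hom)
  let ?q = "(#>) C"
  \<comment> \<open>The commutator of \<open>i g\<close> and \<open>j h\<close> commutes with the
    generators of \<open>L\<close> by \<open>commutator_i_j_delta\<close>, and \<open>p1\<close> and
    \<open>p3\<close> kill it because each of them kills one of the two copies. Hence it lies in
    \<open>C\<close>.\<close>
  have comm: "?q (i g) \<otimes>\<^bsub>H Mod C\<^esub> ?q (j h) = ?q (j h) \<otimes>\<^bsub>H Mod C\<^esub> ?q (i g)"
    if gh: "g \<in> carrier G" "h \<in> carrier G" for g h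
  proof -
    define c where "c = commutator H (i g) (j h)"
    have c: "c \<in> carrier H" "p1 c = \<one>\<^bsub>G\<^esub>" "p3 c = \<one>\<^bsub>G\<^esub>"
      using gh by (simp_all add: c_def p1.hom_commutator p3.hom_commutator)
    have "commutator H l c = \<one>" if "l \<in> L" for l
      unfolding c_def by (rule commutator_L_eq_one[OF _ commutator_i_j_delta that]) (use gh in auto)
    then have "c \<otimes> l = l \<otimes> c" if "l \<in> L" for l
      using H.commutator_eq_one_iff[of l c] that c L.mem_carrier by simp
    with c have "c \<in> C" unfolding C_def by blast
    then have "?q (commutator H (i g) (j h)) = \<one>\<^bsub>H Mod C\<^esub>"
      unfolding c_def[symmetric] using C.coset_eq_one_iff c(1) by blast
    then show ?thesis
      using gh by (simp only: q.hom_commutator i.hom_closed j.hom_closed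
          q.H.commutator_eq_one_iff q.hom_closed)
  qed
  let ?P = "{x \<in> carrier H. ?q x = ?q (i (p1 x)) \<otimes>\<^bsub>H Mod C\<^esub> ?q (j (p3 x))}"
  have "subgroup ?P H"
  proof (rule H.subgroupI)
    show "?P \<noteq> {}" by (auto intro!: exI[of _ \<one>] simp del: mult_FactGroup one_FactGroup)
    fix x assume x: "x \<in> ?P"
    have "?q (inv x) = inv\<^bsub>H Mod C\<^esub> (?q (i (p1 x)) \<otimes>\<^bsub>H Mod C\<^esub> ?q (j (p3 x)))"
      using x by (simp del: mult_FactGroup)
    also have "\<dots> = inv\<^bsub>H Mod C\<^esub> (?q (j (p3 x)) \<otimes>\<^bsub>H Mod C\<^esub> ?q (i (p1 x)))"
      using x by (subst comm) simp_all
    also have "\<dots> = ?q (i (p1 (inv x))) \<otimes>\<^bsub>H Mod C\<^esub> ?q (j (p3 (inv x)))"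
      using x by (simp del: mult_FactGroup add: q.H.inv_mult_group)
    finally show "inv x \<in> ?P" using x by simp
    fix y assume y: "y \<in> ?P"
    define a b c d where "a = ?q (i (p1 x))" and "b = ?q (j (p3 x))"
      and "c = ?q (i (p1 y))" and "d = ?q (j (p3 y))"
    have [simp]: "a \<in> carrier (H Mod C)" "b \<in> carrier (H Mod C)" "c \<in> carrier (H Mod C)"
        "d \<in> carrier (H Mod C)"
      using x y by (simp_all add: a_def b_def c_def d_def)
    have bc: "b \<otimes>\<^bsub>H Mod C\<^esub> c = c \<otimes>\<^bsub>H Mod C\<^esub> b"
      unfolding b_def c_def using x y by (intro comm[symmetric]) auto
    have "?q (x \<otimes> y) = (a \<otimes>\<^bsub>H Mod C\<^esub> b) \<otimes>\<^bsub>H Mod C\<^esub> (c \<otimes>\<^bsub>H Mod C\<^esub> d)"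
      using x y by (simp del: mult_FactGroup add: a_def b_def c_def d_def)
    also have "\<dots> = a \<otimes>\<^bsub>H Mod C\<^esub> (b \<otimes>\<^bsub>H Mod C\<^esub> c) \<otimes>\<^bsub>H Mod C\<^esub> d"
      by (simp del: mult_FactGroup add: q.H.m_assoc)
    also have "\<dots> = (a \<otimes>\<^bsub>H Mod C\<^esub> c) \<otimes>\<^bsub>H Mod C\<^esub> (b \<otimes>\<^bsub>H Mod C\<^esub> d)"
      unfolding bc by (simp del: mult_FactGroup add: q.H.m_assoc)
    also have "\<dots> = ?q (i (p1 (x \<otimes> y))) \<otimes>\<^bsub>H Mod C\<^esub> ?q (j (p3 (x \<otimes> y)))"
      using x y by (simp del: mult_FactGroup add: a_def b_def c_def d_def)
    finally show "x \<otimes> y \<in> ?P" using x y by simp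
  qed auto
  then have "x \<in> ?P"
    by (rule carrier_induct)
      (use x in \<open>auto simp del: mult_FactGroup one_FactGroup\<close>)
  then have "?q x = \<one>\<^bsub>H Mod C\<^esub>" using x by (simp del: mult_FactGroup one_FactGroup)
  then have "x \<in> C" using C.coset_eq_one_iff x by blast
  then have "x \<otimes> l = l \<otimes> x" using l unfolding C_def by blast
  then show ?thesis using H.commutator_eq_one_iff[OF L.mem_carrier[OF l] x(1)] by simp
qed

end

section \<open>Commutation inside \<open>L\<close> and the central subgroup \<open>W\<close>\<close>

context weak_commutativity
begin

lemma commutator_W_eq_one:
  assumes "w \<in> W" "l \<in> L"
  shows "commutator H w l = \<one>" "commutator H l w = \<one>"
proof -
  show *: "commutator H l w = \<one>" using assms by (intro commutator_L_kernels) (auto simp: mem_W)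
  then show "commutator H w l = \<one>"
    using assms by (auto simp: mem_W mem_L H.commutator_eq_one_iff)
qed

lemma W_subset_L: "w \<in> W \<Longrightarrow> w \<in> L" and M1_subset_L: "w \<in> M1 \<Longrightarrow> w \<in> L"
  and M3_subset_L: "w \<in> M3 \<Longrightarrow> w \<in> L"
  by (auto simp: mems)

lemmas L_memI = W_subset_L M1_subset_L M3_subset_L

text \<open>The elements \<open>x\<close> and \<open>y\<close> differ by a factor from
  \<open>L\<close>, which centralizes \<open>W\<close>. So when acting on \<open>W\<close>, an
  element may be traded for either copy of its image under \<open>p2\<close>.\<close>

lemma commutator_W_cong:
  assumes w: "w \<in> W" and x: "x \<in> carrier H" and y: "y \<in> carrier H" and p2: "p2 x = p2 y"
  shows "commutator H w x = commutator H w y"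
proof -
  have wH: "w \<in> carrier H" using w by (simp add: mem_W)
  define t where "t = inv y \<otimes> x"
  have t: "t \<in> L" "t \<in> carrier H" "x = y \<otimes> t"
    using x y p2 by (simp_all add: t_def mem_L H.m_assoc[symmetric])
  have c: "commutator H w y \<in> W" by (rule H.commutator_mem_normal(1)[OF normal_W y w])
  have "commutator H w x = commutator H w t \<otimes> (inv t \<otimes> commutator H w y \<otimes> t)"
    unfolding t(3) by (rule H.commutator_mult_right[OF wH y t(2)])
  also have "\<dots> = commutator H w t \<otimes> (commutator H w y \<otimes> commutator H (commutator H w y) t)"
    using wH y t(2) by (simp add: H.conj_eq_mult_commutator)
  also have "\<dots> = commutator H w y"
    using wH y by (simp add: commutator_W_eq_one(1)[OF _ t(1)] w c)
  finally show ?thesis .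
qed

lemma iter_commutator_W_cong:
  assumes "w \<in> W" "x \<in> carrier H" "y \<in> carrier H" "p2 x = p2 y"
  shows "iter_commutator H w (replicate k x) = iter_commutator H w (replicate k y)"
  using assms(1)
proof (induction k arbitrary: w)
  case (Suc k)
  then show ?case
    using commutator_W_cong[OF Suc.prems assms(2-4)] H.commutator_mem_normal(1)[OF normal_W assms(3)]
    by simp
qed simp

text \<open>A projection kills a commutator as soon as it kills one entry: \<open>p2\<close> kills
  \<open>L\<close>, \<open>p3\<close> kills \<open>i g\<close>, and \<open>p1\<close> kills
  \<open>j g\<close>.\<close>

lemma commutator_L_i: "l \<in> L \<Longrightarrow> g \<in> carrier G \<Longrightarrow> commutator H l (i g) \<in> M3"
  and commutator_L_j: "l \<in> L \<Longrightarrow> g \<in> carrier G \<Longrightarrow> commutator H l (j g) \<in> M1"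
  and commutator_M1_i: "l \<in> M1 \<Longrightarrow> g \<in> carrier G \<Longrightarrow> commutator H l (i g) \<in> W"
  and commutator_M3_j: "l \<in> M3 \<Longrightarrow> g \<in> carrier G \<Longrightarrow> commutator H l (j g) \<in> W"
  by (simp_all add: mems p1.hom_commutator p2.hom_commutator p3.hom_commutator)

text \<open>For a generator [a, b] both [a, i g] and [b, i g] lie in \<open>M3\<close>, so each
  commutator required by \<open>commutator_commutator_mem\<close> has one entry in \<open>M3\<close>
  and the other in \<open>L\<close>.\<close>

lemma commutator_subgroup_L_i:
  assumes z: "z \<in> commutator_subgroup H L L" and g: "g \<in> carrier G"
  shows "commutator H z (i g) \<in> commutator_subgroup H M3 L"
proof (rule H.commutator_mem_generate[OF H.commutator_subgroup_normal[OF normal_M3 normal_L]])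
  let ?C = "commutator_subgroup H M3 L"
  show "z \<in> generate H {commutator H a b | a b. a \<in> L \<and> b \<in> L}"
    using z by (simp add: commutator_subgroup_def)
  have sub: "M3 \<subseteq> carrier H" "L \<subseteq> carrier H" by (auto simp: mems)
  fix t assume "t \<in> {commutator H a b | a b. a \<in> L \<and> b \<in> L}"
  then obtain a b where t: "t = commutator H a b" and ab: "a \<in> L" "b \<in> L" by blast
  have abH: "a \<in> carrier H" "b \<in> carrier H" "i g \<in> carrier H" using ab g by (auto simp: mems)
  have u: "commutator H a (i g) \<in> M3" "commutator H b (i g) \<in> M3"
    using ab g by (simp_all add: commutator_L_i)
  have c: "commutator H a b \<in> L" using H.commutator_mem_normal(1)[OF normal_L abH(2) ab(1)] .
  show "commutator H t (i g) \<in> ?C" unfolding t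
    by (rule H.commutator_commutator_mem[OF H.commutator_subgroup_normal[OF normal_M3 normal_L] abH])
      (use u ab c M3_subset_L in \<open>auto intro: H.commutator_subgroup_mem
        H.commutator_subgroup_mem_swap[OF sub]\<close>)
qed (use g in \<open>auto simp: mems\<close>)

text \<open>Now [a, j g] lies in \<open>W\<close> and commutes with \<open>L\<close>, while [b, j g]
  lies in \<open>M1\<close>. Of the required commutators only [a, [b, j g]] and [[a, b], [b, j g]]
  remain, both with entries in \<open>M3\<close> and \<open>M1\<close>.\<close>

lemma commutator_subgroup_M3_L_j:
  assumes z: "z \<in> commutator_subgroup H M3 L" and g: "g \<in> carrier G"
  shows "commutator H z (j g) \<in> commutator_subgroup H M3 M1"
proof (rule H.commutator_mem_generate[OF H.commutator_subgroup_normal[OF normal_M3 normal_M1]])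
  let ?C = "commutator_subgroup H M3 M1"
  show "z \<in> generate H {commutator H a b | a b. a \<in> M3 \<and> b \<in> L}"
    using z by (simp add: commutator_subgroup_def)
  have one: "\<one> \<in> ?C" by (simp add: commutator_subgroup_def generate.one)
  fix t assume "t \<in> {commutator H a b | a b. a \<in> M3 \<and> b \<in> L}"
  then obtain a b where t: "t = commutator H a b" and ab: "a \<in> M3" "b \<in> L" by blast
  have abH: "a \<in> carrier H" "b \<in> carrier H" "j g \<in> carrier H" using ab g by (auto simp: mems)
  have u: "commutator H a (j g) \<in> W" "commutator H b (j g) \<in> M1"
    using ab g by (simp_all add: commutator_L_j commutator_M3_j)
  have c: "commutator H a b \<in> M3" using H.commutator_mem_normal(1)[OF normal_M3 abH(2) ab(1)] .
  show "commutator H t (j g) \<in> ?C" unfolding t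
    by (rule H.commutator_commutator_mem[OF H.commutator_subgroup_normal[OF normal_M3 normal_M1] abH])
      (use u ab c one L_memI in \<open>auto simp: commutator_W_eq_one intro: H.commutator_subgroup_mem\<close>)
qed (use g in \<open>auto simp: mems\<close>)

text \<open>Conjugation by \<open>i g\<close> turns [a, b] into [av, bw] with v = [a, i g] and w =
  [b, i g]. As w and [a, b] lie in \<open>W\<close> and so commute with \<open>L\<close>, this
  equals [a, b][v, b].\<close>

lemma commutator_M3_M1_i:
  assumes a: "a \<in> M3" and b: "b \<in> M1" and g: "g \<in> carrier G"
  shows "commutator H (commutator H a b) (i g) = commutator H (commutator H a (i g)) b"
proof -
  let ?v = "commutator H a (i g)" and ?w = "commutator H b (i g)"
  have H: "a \<in> carrier H" "b \<in> carrier H" "i g \<in> carrier H" using a b g by (auto simp: mems)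
  have v: "?v \<in> M3" using a g L_memI by (simp add: commutator_L_i)
  have w: "?w \<in> W" using b g by (simp add: commutator_M1_i)
  have vw: "?v \<in> carrier H" "?w \<in> carrier H" using H by auto
  have c: "commutator H a b \<in> W"
    using H.commutator_mem_normal(1)[OF normal_M3 H(2) a] H.commutator_mem_normal(2)[OF normal_M1 H(1) b]
    by (simp add: W_def)
  have "commutator H a b \<otimes> commutator H (commutator H a b) (i g)
      = inv (i g) \<otimes> commutator H a b \<otimes> i g"
    using H by (simp add: H.conj_eq_mult_commutator)
  also have "\<dots> = commutator H (a \<otimes> ?v) (b \<otimes> ?w)"
    unfolding H.conj_commutator[OF H] H.conj_eq_mult_commutator[OF H(1,3)]
      H.conj_eq_mult_commutator[OF H(2,3)] ..
  also have "\<dots> = commutator H (a \<otimes> ?v) ?w \<otimes> (inv ?w \<otimes> commutator H (a \<otimes> ?v) b \<otimes> ?w)"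
    by (rule H.commutator_mult_right) (use H vw in auto)
  also have "a \<otimes> ?v \<in> L"
    using a v L_memI by (auto intro!: subgroup.m_closed[OF normal_imp_subgroup[OF normal_L]])
  then have "commutator H (a \<otimes> ?v) ?w = \<one>" by (rule commutator_W_eq_one(2)[OF w])
  also have "inv ?w \<otimes> commutator H (a \<otimes> ?v) b \<otimes> ?w = commutator H (a \<otimes> ?v) b"
  proof -
    have "commutator H (a \<otimes> ?v) b \<in> L"
      using b L_memI H vw by (intro H.commutator_mem_normal(2)[OF normal_L]) auto
    then have "commutator H (commutator H (a \<otimes> ?v) b) ?w = \<one>" by (rule commutator_W_eq_one(2)[OF w])
    then show ?thesis using H vw by (simp add: H.conj_eq_mult_commutator)
  qed
  also have "commutator H (a \<otimes> ?v) b = inv ?v \<otimes> commutator H a b \<otimes> ?v \<otimes> commutator H ?v b"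
    by (rule H.commutator_mult_left) (use H vw in auto)
  also have "inv ?v \<otimes> commutator H a b \<otimes> ?v = commutator H a b"
    using commutator_W_eq_one(1)[OF c, of ?v] v L_memI H vw by (simp add: H.conj_eq_mult_commutator)
  finally show ?thesis using H vw by simp
qed

lemma iter_commutator_M3_M1_i:
  assumes "a \<in> M3" "b \<in> M1" "g \<in> carrier G"
  shows "iter_commutator H (commutator H a b) (replicate k (i g))
    = commutator H (iter_commutator H a (replicate k (i g))) b"
  using assms(1)
proof (induction k arbitrary: a)
  case (Suc k)
  have "commutator H a (i g) \<in> M3" using Suc.prems assms(3) L_memI by (simp add: commutator_L_i)
  with Suc assms show ?case by (simp add: commutator_M3_M1_i)
qed simp

lemma derived_subset_image_M3:
  "derived G (carrier G) \<subseteq> p1 ` M3"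
proof -
  interpret M3: normal M3 H by (rule normal_M3)
  have sub: "subgroup (p1 ` M3) G" by (rule p1.subgroup_img_is_subgroup[OF M3.is_subgroup])
  have "commutator G a b \<in> p1 ` M3" if ab: "a \<in> carrier G" "b \<in> carrier G" for a b
  proof
    \<comment> \<open>Since \<open>p1\<close> kills \<open>j\<close>, it maps \<open>delta\<close>
      of the inverse of \<open>a\<close> to \<open>a\<close>; commutation with \<open>i b\<close>
      brings the element into \<open>M3\<close>.\<close>
    let ?x = "commutator H (delta (inv\<^bsub>G\<^esub> a)) (i b)"
    show "?x \<in> M3" using ab by (intro commutator_L_i) (auto simp: mem_L delta_def)
    show "commutator G a b = p1 ?x" using ab by (simp add: p1.hom_commutator delta_def)
  qed
  then have "commutator_subgroup G (carrier G) (carrier G) \<subseteq> p1 ` M3"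
    by (intro G.commutator_subgroup_incl sub)
  then show ?thesis by (simp add: G.derived_eq_commutator_subgroup G.subgroup_self)
qed

text \<open>Write z = yw with \<open>y\<close> in the derived subgroup of \<open>M3\<close> and w in
  \<open>W\<close>; the factor w commutes with \<open>b\<close>. For c, d in \<open>M3\<close> both
  [c, b] and [d, b] lie in \<open>W\<close>, so [c, d] commutes with \<open>b\<close>, and hence so
  does \<open>y\<close>.\<close>

lemma commutator_M3_M1_eq_one:
  assumes z: "z \<in> M3" "p1 z \<in> second_derived G" and b: "b \<in> M1"
  shows "commutator H z b = \<one>"
proof -
  interpret M3: normal M3 H by (rule normal_M3)
  have M3H: "M3 \<subseteq> carrier H" by auto
  have bH: "b \<in> carrier H" and bL: "b \<in> L" using b by (auto simp: mems)
  \<comment> \<open>As the image of \<open>M3\<close> contains G', the image of its derived subgroup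
    contains G''; this provides \<open>y\<close>.\<close>
  have "second_derived G \<subseteq> derived G (p1 ` M3)"
    unfolding second_derived_def using derived_subset_image_M3 by (intro G.mono_derived) auto
  also have "\<dots> = p1 ` derived H M3" by (rule p1.derived_img[OF M3H])
  finally obtain y where y: "y \<in> derived H M3" "p1 z = p1 y" using z(2) by auto
  have yM: "y \<in> M3" using y(1) H.derived_incl[OF subset_refl M3.is_subgroup] by blast
  have wW: "inv y \<otimes> z \<in> W"
    using z yM y(2) M3H by (auto simp: mems)
  have "commutator H y b \<in> {\<one>}"
  proof (rule H.commutator_mem_generate[OF H.one_is_normal bH])
    show "y \<in> generate H {commutator H c d | c d. c \<in> M3 \<and> d \<in> M3}"
      using y(1) by (simp add: H.derived_eq_commutator_subgroup[OF M3.is_subgroup] commutator_subgroup_def)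
    fix t assume "t \<in> {commutator H c d | c d. c \<in> M3 \<and> d \<in> M3}"
    then obtain c d where t: "t = commutator H c d" and cd: "c \<in> M3" "d \<in> M3" by blast
    have W: "commutator H c b \<in> W" "commutator H d b \<in> W"
      using cd b bH M3H H.commutator_mem_normal[OF normal_M3] H.commutator_mem_normal[OF normal_M1]
      by (auto simp: W_def)
    have cL: "commutator H c d \<in> L" "c \<in> L" "d \<in> L"
      using cd M3H H.commutator_mem_normal(1)[OF normal_L] L_memI by auto
    have "commutator H (commutator H c d) b = \<one>"
      by (rule H.commutator_commutator_eq_one) (use cd bH M3H W cL L_memI commutator_W_eq_one in auto)
    then show "commutator H t b \<in> {\<one>}" by (simp add: t)
  qed auto
  then have yb: "y \<otimes> b = b \<otimes> y" using yM M3H bH by (auto simp: H.commutator_eq_one_iff)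
  have "commutator H (inv y \<otimes> z) b = \<one>" using wW bL by (rule commutator_W_eq_one(1))
  then have wb: "inv y \<otimes> z \<otimes> b = b \<otimes> (inv y \<otimes> z)"
    using z yM M3H bH by (subst (asm) H.commutator_eq_one_iff) auto
  have H: "y \<in> carrier H" "z \<in> carrier H" using z yM M3H by auto
  have "z \<otimes> b = y \<otimes> (inv y \<otimes> z \<otimes> b)" using H bH by (simp add: H.m_assoc)
  also have "\<dots> = y \<otimes> b \<otimes> (inv y \<otimes> z)" unfolding wb using H bH by (simp add: H.m_assoc)
  also have "\<dots> = b \<otimes> z" unfolding yb using H bH by (simp add: H.m_assoc)
  finally show ?thesis using H bH by (simp add: H.commutator_eq_one_iff)
qed

sublocale W: abelian_normal W H
proof -
  have "a \<otimes> b = b \<otimes> a" if "a \<in> W" "b \<in> W" for a b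
    using commutator_W_eq_one(1)[OF that(1) W_subset_L[OF that(2)]] that
    by (auto simp: mem_W H.commutator_eq_one_iff)
  then show "abelian_normal W H"
    using normal_W by (auto simp: abelian_normal_def abelian_normal_axioms_def)
qed

text \<open>On \<open>W\<close> iterated commutation is a homomorphism, so generators [a, b]
  suffice. There the commutations move onto \<open>a\<close>, whose image under \<open>p1\<close>
  reaches G'' after \<open>d\<close> of them.\<close>

lemma iter_commutator_M3_M1_eq_one:
  assumes d: "\<And>a g. a \<in> carrier G \<Longrightarrow> g \<in> carrier G \<Longrightarrow>
      iter_commutator G a (replicate d g) \<in> second_derived G"
    and z: "z \<in> commutator_subgroup H M3 M1" and g: "g \<in> carrier G"
  shows "iter_commutator H z (replicate d (i g)) = \<one>"
proof -
  have ig: "set (replicate d (i g)) \<subseteq> carrier H" using g by auto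
  have "subgroup {z \<in> W. iter_commutator H z (replicate d (i g)) = \<one>} H"
  proof (rule H.subgroupI)
    have "\<one> \<in> {z \<in> W. iter_commutator H z (replicate d (i g)) = \<one>}" using ig by (simp add: mem_W)
    then show "{z \<in> W. iter_commutator H z (replicate d (i g)) = \<one>} \<noteq> {}" by blast
  qed (use ig in \<open>auto simp: W.iter_commutator_inv W.iter_commutator_mult\<close>)
  moreover have "commutator H a b \<in> {z \<in> W. iter_commutator H z (replicate d (i g)) = \<one>}"
    if ab: "a \<in> M3" "b \<in> M1" for a b
  proof -
    have abH: "a \<in> carrier H" "b \<in> carrier H" using ab by (auto simp: mems)
    have "commutator H a b \<in> W"
      using H.commutator_mem_normal(1)[OF normal_M3 abH(2) ab(1)]
        H.commutator_mem_normal(2)[OF normal_M1 abH(1) ab(2)] by (simp add: W_def)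
    moreover have "p1 (iter_commutator H a (replicate d (i g))) \<in> second_derived G"
      using abH ig g by (simp add: p1.hom_iter_commutator d)
    then have "commutator H (iter_commutator H a (replicate d (i g))) b = \<one>"
      using ig ab by (intro commutator_M3_M1_eq_one H.iter_commutator_mem_normal[OF normal_M3]) auto
    ultimately show ?thesis using ab g by (simp add: iter_commutator_M3_M1_i)
  qed
  ultimately have "commutator_subgroup H M3 M1 \<subseteq> {z \<in> W. iter_commutator H z (replicate d (i g)) = \<one>}"
    by (rule H.commutator_subgroup_incl)
  then show ?thesis using z by blast
qed

text \<open>The bound counts \<open>n\<close> commutations to reach \<open>W\<close>,
  \<open>s\<close> more to reach L', one read as \<open>i g\<close> and one read as
  \<open>j g\<close> to reach [M3, M1], and \<open>d\<close> to reach the neutral element.\<close>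

lemma engel_carrier:
  assumes n: "engel n G"
    and d: "\<And>a g. a \<in> carrier G \<Longrightarrow> g \<in> carrier G \<Longrightarrow>
      iter_commutator G a (replicate d g) \<in> second_derived G"
    and s: "\<And>l g. l \<in> L \<Longrightarrow> g \<in> carrier G \<Longrightarrow>
      iter_commutator H l (replicate s (i g)) \<in> commutator_subgroup H L L"
    and m: "n + s + 2 + d \<le> m"
  shows "engel m H"
  unfolding engel_def
proof (intro ballI)
  fix x y assume x: "x \<in> carrier H" and y: "y \<in> carrier H"
  have rep: "set (replicate k y) \<subseteq> carrier H" for k using y by auto
  define g where "g = p2 y"
  have g: "g \<in> carrier G" and py: "p2 y = p2 (i g)" "p2 y = p2 (j g)" using y by (simp_all add: g_def)
  have ig: "i g \<in> carrier H" "j g \<in> carrier H" using g by auto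
  define a where "a = iter_commutator H x (replicate n y)"
  \<comment> \<open>Each of the three projections of \<open>a\<close> is an n-fold Engel commutator
    in \<open>G\<close>.\<close>
  have aW: "a \<in> W"
    using n x y rep by (simp add: mem_W a_def p1.hom_iter_commutator p2.hom_iter_commutator
        p3.hom_iter_commutator engel_def)
  define b where "b = iter_commutator H a (replicate s y)"
  have bW: "b \<in> W" using aW rep by (simp add: b_def)
  have "b = iter_commutator H a (replicate s (i g))"
    unfolding b_def by (rule iter_commutator_W_cong[OF aW y ig(1) py(1)])
  then have bL: "b \<in> commutator_subgroup H L L" using s[OF W_subset_L[OF aW] g] by simp
  define c where "c = commutator H b y"
  have cW: "c \<in> W" using bW y by (simp add: c_def)
  have "c = commutator H b (i g)"
    unfolding c_def by (rule commutator_W_cong[OF bW y ig(1) py(1)])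
  then have cM: "c \<in> commutator_subgroup H M3 L" using commutator_subgroup_L_i[OF bL g] by simp
  define e where "e = commutator H c y"
  have eW: "e \<in> W" using cW y by (simp add: e_def)
  have "e = commutator H c (j g)"
    unfolding e_def by (rule commutator_W_cong[OF cW y ig(2) py(2)])
  then have eM: "e \<in> commutator_subgroup H M3 M1" using commutator_subgroup_M3_L_j[OF cM g] by simp
  have "iter_commutator H e (replicate d y) = iter_commutator H e (replicate d (i g))"
    by (rule iter_commutator_W_cong[OF eW y ig(1) py(1)])
  also have "\<dots> = \<one>" by (rule iter_commutator_M3_M1_eq_one[OF d eM g])
  finally have e1: "iter_commutator H e (replicate d y) = \<one>" .
  obtain r where r: "m = n + (s + (Suc (Suc (d + r))))" using m by (auto simp: le_iff_add)
  show "iter_commutator H x (replicate m y) = \<one>"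
    unfolding r replicate_add iter_commutator_append replicate_Suc iter_commutator_Cons
      a_def[symmetric] b_def[symmetric] c_def[symmetric] e_def[symmetric] e1
    by (rule H.iter_commutator_one[OF rep])
qed

end

section \<open>The two nilpotency classes exist\<close>

text \<open>The products \<open>x \<otimes> y\<close> and \<open>y \<otimes> x\<close> differ by an
  element of \<open>A\<close>, which acts trivially on \<open>A\<close>. Comparing their expansions
  gives (x - 1)(y - 1) = (y - 1)(x - 1).\<close>

lemma (in abelian_normal) commutator_swap:
  assumes a: "a \<in> A" and x: "x \<in> carrier G" and y: "y \<in> carrier G"
    and xy: "commutator G x y \<in> A"
  shows "commutator G (commutator G a x) y = commutator G (commutator G a y) x"
proof -
  have c: "commutator G b (commutator G x y) = \<one>" if "b \<in> A" for b
    using that xy comm[OF that xy] by (simp add: commutator_eq_one_iff)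
  have "commutator G a (x \<otimes> y) = commutator G a (y \<otimes> x)"
    using commutator_mult_right'[OF a, of "y \<otimes> x" "commutator G x y"] a x y
    by (simp add: mult_eq_iff_commutator[OF x y] c)
  then have "commutator G a y \<otimes> (commutator G a x \<otimes> commutator G (commutator G a x) y)
    = commutator G a x \<otimes> (commutator G a y \<otimes> commutator G (commutator G a y) x)"
    using a x y by (simp add: commutator_mult_right')
  also have "\<dots> = commutator G a y \<otimes> (commutator G a x \<otimes> commutator G (commutator G a y) x)"
    by (rule left_comm) (use a x y in auto)
  finally show ?thesis using a x y by simp
qed

lemma (in group) iter_commutator_mem_lower_central:
  assumes "a \<in> carrier G" "set gs \<subseteq> carrier G"
  shows "iter_commutator G a gs \<in> lower_central G (length gs)"
  using assms(2)
proof (induction gs rule: rev_induct)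
  case (snoc g gs)
  then show ?case by (auto simp: iter_commutator_append intro!: generate.incl)
qed (use assms in simp)

text \<open>The term with index 1 is the derived subgroup, that is \<open>annih\<close> with index
  \<open>N\<close>; each further term lowers this index by one until \<open>annih_0\<close>
  applies.\<close>

lemma (in group) lower_central_annih:
  assumes "abelian_normal (derived G (carrier G)) G"
    and N: "abelian_normal.annih (derived G (carrier G)) G (carrier G) N = derived G (carrier G)"
  shows "lower_central G (Suc N) = {\<one>}"
proof -
  interpret A: abelian_normal "derived G (carrier G)" G by fact
  have "lower_central G (Suc k) \<subseteq> A.annih (carrier G) (N - k)" if "k \<le> N" for k
    using that
  proof (induction k)
    case 0
    have "lower_central G (Suc 0) = derived G (carrier G)"
      unfolding derived_eq_commutator_subgroup[OF subgroup_self] commutator_subgroup_def by simp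
    also have "\<dots> = A.annih (carrier G) (N - 0)" by (simp add: N)
    finally show ?case by (rule equalityD1)
  next
    case (Suc k)
    then have "lower_central G (Suc k) \<subseteq> A.annih (carrier G) (Suc (N - Suc k))"
      by (simp add: Suc_diff_Suc)
    then have "{commutator G x g | x g. x \<in> lower_central G (Suc k) \<and> g \<in> carrier G}
        \<subseteq> A.annih (carrier G) (N - Suc k)"
      by (auto simp: A.annih_Suc simp del: lower_central.simps)
    then show ?case
      unfolding lower_central.simps(2)[of G "Suc k"]
      by (intro generate_subgroup_incl A.subgroup_annih) auto
  qed
  from this[of N] have "lower_central G (Suc N) \<subseteq> {\<one>}" by simp
  moreover have "\<one> \<in> lower_central G (Suc N)" by (simp add: generate.one)
  ultimately show ?thesis by blast
qed

lemma (in group_hom) engel_image: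
  assumes "engel n G" "h ` carrier G = carrier H"
  shows "engel n H"
  unfolding engel_def
proof (intro ballI)
  fix a b assume "a \<in> carrier H" "b \<in> carrier H"
  then obtain x y where xy: "x \<in> carrier G" "y \<in> carrier G" "a = h x" "b = h y"
    using assms(2) by blast
  have "set (replicate n y) \<subseteq> carrier G" using xy(2) by auto
  then have "iter_commutator H a (replicate n b) = h (iter_commutator G x (replicate n y))"
    using xy by (simp add: hom_iter_commutator)
  then show "iter_commutator H a (replicate n b) = \<one>\<^bsub>H\<^esub>" using assms(1) xy by (simp add: engel_def)
qed

text \<open>The metabelian case of Gruenberg's theorem: on the abelian derived subgroup the
  operators of the generators commute, and by the Engel condition their n-th powers vanish.\<close>

lemma (in group) metabelian_engel_nilpotent:
  assumes S: "finite S" "S \<subseteq> carrier G" "generate G S = carrier G"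
    and n: "engel n G" and metab: "derived G (derived G (carrier G)) = {\<one>}"
  shows "\<exists>c. lower_central G c = {\<one>}"
proof -
  let ?A = "derived G (carrier G)"
  have nA: "?A \<lhd> G" by (rule derived_normal[OF normal_self])
  interpret nA: normal ?A G by (rule nA)
  have "a \<otimes> b = b \<otimes> a" if "a \<in> ?A" "b \<in> ?A" for a b
  proof -
    have "commutator G a b \<in> derived G ?A"
      unfolding derived_eq_commutator_subgroup[OF nA.is_subgroup]
      by (rule commutator_subgroup_mem[OF that])
    then show ?thesis
      using that metab commutator_eq_one_iff[of a b] nA.mem_carrier by simp
  qed
  then interpret A: abelian_normal ?A G
    using nA by (simp add: abelian_normal_def abelian_normal_axioms_def)
  have c: "commutator G x y \<in> ?A" if "x \<in> carrier G" "y \<in> carrier G" for x y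
    using commutator_subgroup_mem[OF that]
    by (simp add: derived_eq_commutator_subgroup[OF subgroup_self])
  have "A.annih (generate G S) (Suc (card S * n)) = ?A"
  proof (rule A.annih_generate_eq[OF S(1,2)])
    fix a x assume a: "a \<in> ?A" and x: "x \<in> S"
    then have xG: "x \<in> carrier G" using S(2) by blast
    show "iter_commutator G a (replicate n x) = \<one>"
      using n xG nA.mem_carrier[OF a] by (simp add: engel_def)
    fix y assume "y \<in> S"
    then have yG: "y \<in> carrier G" using S(2) by blast
    show "commutator G (commutator G a y) x = commutator G (commutator G a x) y \<or>
        commutator G (commutator G a y) x = inv (commutator G (commutator G a x) y)"
      using A.commutator_swap[OF a yG xG c[OF yG xG]] by blast
  qed
  then have "lower_central G (Suc (Suc (card S * n))) = {\<one>}"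
    unfolding S(3) by (intro lower_central_annih A.abelian_normal_axioms)
  then show ?thesis by blast
qed

text \<open>The quotient by G'' is finitely generated, Engel and metabelian, hence nilpotent. So the
  minimum defining \<open>nilpotency_class\<close> is attained, and commutators of that length
  vanish in the quotient.\<close>

lemma (in group) engel_second_derived:
  assumes fg: "finitely_generated_group G" and n: "engel n G"
    and a: "a \<in> carrier G" and g: "g \<in> carrier G"
  shows "iter_commutator G a (replicate (nilpotency_class (G Mod second_derived G)) g) \<in> second_derived G"
proof -
  have nN: "second_derived G \<lhd> G"
    unfolding second_derived_def by (intro derived_normal normal_self)
  interpret N: normal "second_derived G" G by (rule nN)
  let ?Q = "G Mod second_derived G" and ?q = "(#>) (second_derived G)"
  interpret q: group_hom G ?Q ?q by (rule N.quotient_hom)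
  let ?d = "nilpotency_class ?Q"
  have car: "?q ` carrier G = carrier ?Q" by (simp add: carrier_FactGroup)
  obtain S where S: "finite S" "S \<subseteq> carrier G" "generate G S = carrier G"
    using fg by (auto simp: finitely_generated_group_def)
  have der: "derived ?Q (carrier ?Q) = ?q ` derived G (carrier G)"
    unfolding car[symmetric] by (rule q.derived_img) simp
  have "derived ?Q (derived ?Q (carrier ?Q)) = ?q ` derived G (derived G (carrier G))"
    unfolding der by (rule q.derived_img[OF derived_in_carrier]) simp
  also have "derived G (derived G (carrier G)) = second_derived G"
    by (simp only: second_derived_def)
  also have "?q ` second_derived G = {\<one>\<^bsub>?Q\<^esub>}"
    using N.coset_eq_one_iff[OF N.mem_carrier] N.one_closed by blast
  finally have metab: "derived ?Q (derived ?Q (carrier ?Q)) = {\<one>\<^bsub>?Q\<^esub>}" .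
  have "\<exists>c. lower_central ?Q c = {\<one>\<^bsub>?Q\<^esub>}"
  proof (rule q.H.metabelian_engel_nilpotent[OF _ _ _ q.engel_image[OF n car] metab])
    show "finite (?q ` S)" using S by simp
    show "?q ` S \<subseteq> carrier ?Q" using S(2) car by blast
    show "generate ?Q (?q ` S) = carrier ?Q"
      using q.generate_img[OF S(2)] S(3) car by simp
  qed
  then have d: "lower_central ?Q ?d = {\<one>\<^bsub>?Q\<^esub>}"
    unfolding nilpotency_class_def by (rule LeastI_ex)
  have gs: "set (replicate ?d g) \<subseteq> carrier G" using g by auto
  then have "set (map ?q (replicate ?d g)) \<subseteq> carrier ?Q" using car by auto
  from q.H.iter_commutator_mem_lower_central[OF q.hom_closed[OF a] this]
  have "iter_commutator ?Q (?q a) (map ?q (replicate ?d g)) = \<one>\<^bsub>?Q\<^esub>"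
    unfolding length_map length_replicate d by blast
  then have "?q (iter_commutator G a (replicate ?d g)) = \<one>\<^bsub>?Q\<^esub>"
    unfolding q.hom_iter_commutator[OF a gs] .
  then show ?thesis using N.coset_eq_one_iff[OF iter_commutator_closed[OF a gs]] by blast
qed

section \<open>Nilpotency of the action on L/L'\<close>

context weak_commutativity
begin

lemma delta_mult:
  assumes "g \<in> carrier G" "h \<in> carrier G"
  shows "delta (g \<otimes>\<^bsub>G\<^esub> h) = inv (i h) \<otimes> delta g \<otimes> i h \<otimes> delta h"
  unfolding conj_delta[OF assms] using assms by (simp add: H.m_assoc)

lemma commutator_delta_i:
  assumes [simp]: "g \<in> carrier G"
  shows "commutator H (delta g) (i g) = \<one>"
proof -
  have "delta g \<otimes> i g = inv (i g) \<otimes> (j g \<otimes> i g)" by (simp add: delta_def H.m_assoc)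
  also have "\<dots> = i g \<otimes> delta g" by (simp add: delta_def ij[symmetric])
  finally show ?thesis by (simp add: H.commutator_eq_one_iff)
qed

text \<open>In additive notation \<open>L/L'\<close> is generated by the values of a derivation \<open>\<delta>\<close> with
  \<open>\<delta>\<^sub>g (g - 1) = 0\<close>. Computing \<open>\<delta>\<^bsub>kh\<^esub> = \<delta>\<^bsub>hg\<^esub>\<close> for \<open>k = h g h\<inverse>\<close> in two ways gives
  \<open>\<delta>\<^sub>h (g - 1) = \<delta>\<^sub>k h - \<delta>\<^sub>g\<close>, and both terms are annihilated by \<open>g - 1\<close>.\<close>

lemma commutator_delta:
  assumes g: "g \<in> carrier G" and h: "h \<in> carrier G"
  obtains u v where "u \<in> L" "v \<in> L" "commutator H u (i g) = \<one>" "commutator H v (i g) = \<one>"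
    "commutator H (delta h) (i g) = inv (delta h) \<otimes> u \<otimes> delta h \<otimes> inv v"
proof -
  note [simp] = g h
  define k where "k = h \<otimes>\<^bsub>G\<^esub> g \<otimes>\<^bsub>G\<^esub> inv\<^bsub>G\<^esub> h"
  have k [simp]: "k \<in> carrier G" by (simp add: k_def)
  have kh: "k \<otimes>\<^bsub>G\<^esub> h = h \<otimes>\<^bsub>G\<^esub> g" by (simp add: k_def G.m_assoc)
  let ?u = "inv (i h) \<otimes> delta k \<otimes> i h"
  have dL: "delta x \<in> L" if "x \<in> carrier G" for x using that by (simp add: mem_L delta_def)
  have 1: "delta g \<in> L" "commutator H (delta g) (i g) = \<one>"
    by (simp_all add: dL commutator_delta_i)
  have 2: "?u \<in> L"
    by (rule normal.inv_op_closed1[OF normal_L]) (simp_all add: dL)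
  have "inv (i h) \<otimes> i k \<otimes> i h = i (inv\<^bsub>G\<^esub> h \<otimes>\<^bsub>G\<^esub> (k \<otimes>\<^bsub>G\<^esub> h))" by (simp add: H.m_assoc)
  also have "\<dots> = i g" by (simp only: kh) simp
  finally have "commutator H ?u (i g) = inv (i h) \<otimes> commutator H (delta k) (i k) \<otimes> i h"
    by (simp add: H.conj_commutator)
  then have 3: "commutator H ?u (i g) = \<one>" by (simp add: commutator_delta_i)
  have "?u \<otimes> delta h = inv (i g) \<otimes> delta h \<otimes> i g \<otimes> delta g"
    using delta_mult[of k h] delta_mult[of h g] by (simp add: kh)
  also have "\<dots> = delta h \<otimes> commutator H (delta h) (i g) \<otimes> delta g"
    by (simp add: H.conj_eq_mult_commutator)
  finally have e: "?u \<otimes> delta h = delta h \<otimes> commutator H (delta h) (i g) \<otimes> delta g" .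
  have "inv (delta h) \<otimes> ?u \<otimes> delta h \<otimes> inv (delta g)
      = inv (delta h) \<otimes> (?u \<otimes> delta h) \<otimes> inv (delta g)"
    by (simp add: H.m_assoc)
  also have "\<dots> = commutator H (delta h) (i g)"
    unfolding e by (simp add: H.m_assoc)
  finally show ?thesis by (intro that[OF 2 1(1) 3 1(2)]) simp
qed

text \<open>On L/L' every operator g - 1 has square zero, so any two of them anticommute by
  \<open>square_zero_anticommute\<close>, and \<open>annih_generate_eq\<close> applies with exponent
  2 to a finite generating set.\<close>

lemma action_nilpotent:
  assumes "finitely_generated_group G"
  shows "\<exists>s. \<forall>l\<in>L. \<forall>gs. set gs \<subseteq> carrier G \<and> length gs = s \<longrightarrow>
    iter_commutator H l (map i gs) \<in> derived H L"
proof -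
  let ?D = "derived H L"
  have nD: "?D \<lhd> H" by (rule H.derived_normal[OF normal_L])
  interpret L: normal L H by (rule normal_L)
  interpret D: normal ?D H by (rule nD)
  let ?Q = "H Mod ?D"
  define q where "q = (#>) ?D"
  interpret q: group_hom H ?Q q unfolding q_def by (rule D.quotient_hom)
  have q1: "q x = \<one>\<^bsub>?Q\<^esub> \<longleftrightarrow> x \<in> ?D" if "x \<in> carrier H" for x
    using D.coset_eq_one_iff[OF that] by (simp add: q_def)
  have car: "q ` carrier H = carrier ?Q" by (simp add: carrier_FactGroup q_def)
  let ?A = "q ` L"
  have "?A \<lhd> ?Q"
    by (rule L.surj_hom_normal_subgroup[OF q.group_hom_axioms car])
  moreover have "a \<otimes>\<^bsub>?Q\<^esub> b = b \<otimes>\<^bsub>?Q\<^esub> a" if "a \<in> ?A" "b \<in> ?A" for a b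
  proof -
    obtain k l where kl: "k \<in> L" "l \<in> L" "a = q k" "b = q l" using \<open>a \<in> ?A\<close> \<open>b \<in> ?A\<close> by blast
    have "commutator H k l \<in> ?D"
      unfolding H.derived_eq_commutator_subgroup[OF L.is_subgroup]
      by (rule H.commutator_subgroup_mem[OF kl(1,2)])
    then have "commutator ?Q a b = \<one>\<^bsub>?Q\<^esub>"
      using kl q1[of "commutator H k l"] q.hom_commutator[of k l] L.mem_carrier by simp
    then show ?thesis using q.H.commutator_eq_one_iff[of a b] kl L.mem_carrier by simp
  qed
  ultimately interpret A: abelian_normal ?A ?Q
    by (simp add: abelian_normal_def abelian_normal_axioms_def)
  have sq: "commutator ?Q (commutator ?Q a (q (i g))) (q (i g)) = \<one>\<^bsub>?Q\<^esub>"
    if g: "g \<in> carrier G" and a: "a \<in> ?A" for g a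
  proof -
    let ?x = "q (i g)"
    have x: "?x \<in> carrier ?Q" using g by simp
    let ?K = "{a \<in> ?A. commutator ?Q (commutator ?Q a ?x) ?x = \<one>\<^bsub>?Q\<^esub>}"
    have "subgroup ?K ?Q"
    proof (rule q.H.subgroupI)
      have "\<one>\<^bsub>?Q\<^esub> \<in> ?K" using x A.one_closed by (simp del: one_FactGroup)
      then show "?K \<noteq> {}" by blast
    qed (use x in \<open>auto simp: A.commutator_inv A.commutator_mult simp del: mult_FactGroup one_FactGroup\<close>)
    \<comment> \<open>Modulo L' the conjugation by \<open>delta h\<close> in
      \<open>commutator_delta\<close> disappears, so g - 1 maps \<open>delta h\<close> to a quotient
      of two elements that g - 1 kills.\<close>
    moreover have "q (delta h) \<in> ?K" if h: "h \<in> carrier G" for h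
    proof -
      obtain u v where uv: "u \<in> L" "v \<in> L" "commutator H u (i g) = \<one>" "commutator H v (i g) = \<one>"
        "commutator H (delta h) (i g) = inv (delta h) \<otimes> u \<otimes> delta h \<otimes> inv v"
        by (rule commutator_delta[OF g h])
      have dL: "delta h \<in> L" using h by (simp add: mem_L delta_def)
      have A: "q u \<in> ?A" "q v \<in> ?A" "q (delta h) \<in> ?A" using uv dL by auto
      have c: "commutator ?Q (q u) ?x = \<one>\<^bsub>?Q\<^esub>" "commutator ?Q (q v) ?x = \<one>\<^bsub>?Q\<^esub>"
        using uv g q.hom_commutator[of u "i g"] q.hom_commutator[of v "i g"] L.mem_carrier
        by simp_all
      have "commutator ?Q (q (delta h)) ?x = q (inv (delta h) \<otimes> u \<otimes> delta h \<otimes> inv v)"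
        unfolding uv(5)[symmetric] using g h by (simp add: q.hom_commutator)
      also have "\<dots> = inv\<^bsub>?Q\<^esub> q (delta h) \<otimes>\<^bsub>?Q\<^esub> (q u \<otimes>\<^bsub>?Q\<^esub> q (delta h)) \<otimes>\<^bsub>?Q\<^esub> inv\<^bsub>?Q\<^esub> q v"
        using uv h L.mem_carrier by (simp add: q.H.m_assoc del: mult_FactGroup)
      also have "\<dots> = q u \<otimes>\<^bsub>?Q\<^esub> inv\<^bsub>?Q\<^esub> q v"
        using A by (subst A.comm[of "q u"]) (simp_all del: mult_FactGroup one_FactGroup add: q.H.m_assoc[symmetric])
      finally have "commutator ?Q (commutator ?Q (q (delta h)) ?x) ?x = \<one>\<^bsub>?Q\<^esub>"
        using A x c by (simp add: A.commutator_mult A.commutator_inv del: mult_FactGroup one_FactGroup)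
      then show ?thesis using A by simp
    qed
    ultimately have "generate ?Q (q ` delta ` carrier G) \<subseteq> ?K"
      by (intro q.H.generate_subgroup_incl) auto
    moreover have "generate ?Q (q ` delta ` carrier G) = ?A"
      by (subst q.generate_img) (auto simp flip: L_eq_generate)
    ultimately show ?thesis using a by blast
  qed
  obtain S where S: "finite S" "S \<subseteq> carrier G" "generate G S = carrier G"
    using assms by (auto simp: finitely_generated_group_def)
  have iS: "i ` S \<subseteq> carrier H" "q ` i ` S \<subseteq> carrier ?Q" using S(2) by auto
  have gen: "generate ?Q (q ` i ` S) = q ` i ` carrier G"
    using q.generate_img[OF iS(1)] i.generate_img[OF S(2)] S(3) by simp
  have "A.annih (generate ?Q (q ` i ` S)) (Suc (card (q ` i ` S) * 2)) = ?A"
  proof (rule A.annih_generate_eq)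
    fix a x assume a: "a \<in> ?A" and x: "x \<in> q ` i ` S"
    then obtain g where g: "g \<in> carrier G" "x = q (i g)" using S(2) by blast
    show "iter_commutator ?Q a (replicate 2 x) = \<one>\<^bsub>?Q\<^esub>"
      using sq[OF g(1) a] g(2) by (simp add: numeral_2_eq_2)
    fix y assume "y \<in> q ` i ` S"
    then obtain h where h: "h \<in> carrier G" "y = q (i h)" using S(2) by blast
    have hg: "y \<otimes>\<^bsub>?Q\<^esub> x = q (i (h \<otimes>\<^bsub>G\<^esub> g))" using g h by (simp del: mult_FactGroup)
    have "commutator ?Q (commutator ?Q a y) x = inv\<^bsub>?Q\<^esub> (commutator ?Q (commutator ?Q a x) y)"
    proof (rule A.square_zero_anticommute)
      fix b assume b: "b \<in> ?A"
      show "commutator ?Q (commutator ?Q b (y \<otimes>\<^bsub>?Q\<^esub> x)) (y \<otimes>\<^bsub>?Q\<^esub> x) = \<one>\<^bsub>?Q\<^esub>"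
        unfolding hg by (rule sq[OF _ b]) (use g h in simp)
    qed (use g h a sq in auto)
    then show "commutator ?Q (commutator ?Q a y) x = commutator ?Q (commutator ?Q a x) y \<or>
        commutator ?Q (commutator ?Q a y) x = inv\<^bsub>?Q\<^esub> (commutator ?Q (commutator ?Q a x) y)" ..
  qed (use S iS in auto)
  then have annih: "A.annih (q ` i ` carrier G) (Suc (card (q ` i ` S) * 2)) = ?A" unfolding gen .
  show ?thesis
  proof (intro exI[of _ "Suc (card (q ` i ` S) * 2)"] ballI allI impI)
    fix l gs assume l: "l \<in> L" and gs: "set gs \<subseteq> carrier G \<and> length gs = Suc (card (q ` i ` S) * 2)"
    have igs: "set (map i gs) \<subseteq> carrier H" using gs by auto
    have lH: "l \<in> carrier H" using l by (rule L.mem_carrier)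
    have "q l \<in> A.annih (q ` i ` carrier G) (Suc (card (q ` i ` S) * 2))" unfolding annih using l by blast
    then have "iter_commutator ?Q (q l) (map q (map i gs)) = \<one>\<^bsub>?Q\<^esub>"
      by (rule A.annihD) (use gs in auto)
    then have "q (iter_commutator H l (map i gs)) = \<one>\<^bsub>?Q\<^esub>"
      unfolding q.hom_iter_commutator[OF lH igs] .
    then show "iter_commutator H l (map i gs) \<in> derived H L"
      using q1[OF H.iter_commutator_closed[OF lH igs]] by blast
  qed
qed

end

section \<open>The group \<open>\<XX>(G)\<close>\<close>

text \<open>The universal property of \<open>XX G\<close>: the lift to the free product kills the
  relators since \<open>f x\<close> and \<open>g x\<close> commute, hence it kills their normal
  closure and factors through the quotient.\<close>

lemma XX_lift:
  fixes G :: "('a, 'b) monoid_scheme" and K :: "('k, 'e) monoid_scheme"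
  assumes G: "group G" and K: "group K" and f: "f \<in> hom G K" and g: "g \<in> hom G K"
    and comm: "\<And>x. x \<in> carrier G \<Longrightarrow> f x \<otimes>\<^bsub>K\<^esub> g x = g x \<otimes>\<^bsub>K\<^esub> f x"
  obtains p where "p \<in> hom (XX G) K" "\<And>x. x \<in> carrier G \<Longrightarrow> p (XX_inl G x) = f x"
    "\<And>x. x \<in> carrier G \<Longrightarrow> p (XX_inr G x) = g x"
proof -
  interpret F: group "free_product G G" by (rule group_free_product[OF G G])
  interpret K: group K by (rule K)
  let ?p = "fp_lift K f g"
  let ?N = "normal_closure (free_product G G) (XX_relators G)"
  interpret p: group_hom "free_product G G" K ?p
    using fp_lift_hom[OF G G K f g] by unfold_locales
  have nN: "?N \<lhd> free_product G G"
    by (rule F.normal_closure_normal[OF XX_relators_closed[OF G]])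
  interpret N: normal ?N "free_product G G" by (rule nN)
  have "XX_relators G \<subseteq> kernel (free_product G G) K ?p"
  proof
    fix r assume r: "r \<in> XX_relators G"
    then obtain x where x: "x \<in> carrier G"
      "r = commutator (free_product G G) (fp_inl G G x) (fp_inr G G x)"
      by (auto simp: XX_relators_def)
    have "?p r = commutator K (f x) (g x)"
      using x hom_in_carrier[OF fp_inl_hom[OF G G] x(1)] hom_in_carrier[OF fp_inr_hom[OF G G] x(1)]
      by (simp add: p.hom_commutator fp_lift_inl[OF G G K f g] fp_lift_inr[OF G G K f g])
    also have "\<dots> = \<one>\<^bsub>K\<^esub>"
      using comm x hom_in_carrier[OF f] hom_in_carrier[OF g] by (simp add: K.commutator_eq_one_iff)
    finally show "r \<in> kernel (free_product G G) K ?p"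
      using r XX_relators_closed[OF G] by (auto simp: kernel_def)
  qed
  then have ker: "?N \<subseteq> kernel (free_product G G) K ?p"
    by (rule F.normal_closure_least[OF p.normal_kernel])
  have "?p A = ?p B"
    if "A \<in> carrier (free_product G G)" "B \<in> carrier (free_product G G)"
      "?N #>\<^bsub>free_product G G\<^esub> A = ?N #>\<^bsub>free_product G G\<^esub> B" for A B
  proof -
    have "A \<in> ?N #>\<^bsub>free_product G G\<^esub> B"
      using F.rcos_self[OF that(1) N.is_subgroup] that(3) by simp
    then show ?thesis using ker that(2) by (auto simp: r_coset_def kernel_def)
  qed
  from FactGroup_universal[OF fp_lift_hom[OF G G K f g] nN this] obtain q
    where q: "q \<in> hom (free_product G G Mod ?N) K"
      "\<And>A. A \<in> carrier (free_product G G) \<Longrightarrow> q (?N #>\<^bsub>free_product G G\<^esub> A) = ?p A"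
    by blast
  show ?thesis
  proof (rule that[of q])
    show "q \<in> hom (XX G) K" using q(1) by (simp add: XX_def)
    fix x assume x: "x \<in> carrier G"
    show "q (XX_inl G x) = f x"
      using q(2)[OF hom_in_carrier[OF fp_inl_hom[OF G G] x]] fp_lift_inl[OF G G K f g x]
      by (simp add: XX_inl_def XX_quot_def)
    show "q (XX_inr G x) = g x"
      using q(2)[OF hom_in_carrier[OF fp_inr_hom[OF G G] x]] fp_lift_inr[OF G G K f g x]
      by (simp add: XX_inr_def XX_quot_def)
  qed
qed

lemma XX_generate:
  assumes G: "group G"
  shows "generate (XX G) (XX_inl G ` carrier G \<union> XX_inr G ` carrier G) = carrier (XX G)"
proof
  interpret H: group "XX G" by (rule group_XX[OF G])
  interpret q: group_hom "free_product G G" "XX G" "XX_quot G"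
    using group_free_product[OF G G] H.is_group XX_quot_hom[OF G]
    by (simp add: group_hom_def group_hom_axioms_def)
  let ?S = "XX_inl G ` carrier G \<union> XX_inr G ` carrier G"
  have S: "?S \<subseteq> carrier (XX G)"
    using hom_in_carrier[OF XX_inl_hom[OF G]] hom_in_carrier[OF XX_inr_hom[OF G]] by blast
  then show "generate (XX G) ?S \<subseteq> carrier (XX G)" by (rule H.generate_incl)
  have "XX_quot G (fp_class G G w) \<in> generate (XX G) ?S" if "w \<in> fp_words G G" for w
    using that
  proof (induction w)
    case Nil
    have "fp_class G G [] = \<one>\<^bsub>free_product G G\<^esub>" by (simp add: free_product_def)
    then show ?case by (simp add: generate.one)
  next
    case (Cons a w)
    then have w: "w \<in> fp_words G G" and a: "[a] \<in> fp_words G G" by (auto simp: fp_words_def)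
    have "XX_quot G (fp_class G G [a]) \<in> ?S"
      using a by (cases a) (auto simp: fp_words_def XX_inl_def XX_inr_def fp_inl_def fp_inr_def)
    then have "XX_quot G (fp_class G G [a]) \<otimes>\<^bsub>XX G\<^esub> XX_quot G (fp_class G G w)
        \<in> generate (XX G) ?S"
      by (rule generate.eng[OF generate.incl Cons.IH[OF w]])
    moreover have "fp_class G G [a] \<in> carrier (free_product G G)"
      "fp_class G G w \<in> carrier (free_product G G)"
      using a w by (simp_all add: free_product_def)
    ultimately show ?case using fp_mult[OF G G a w] by (simp flip: q.hom_mult)
  qed
  then show "carrier (XX G) \<subseteq> generate (XX G) ?S"
    by (auto simp: XX_def carrier_FactGroup XX_quot_def free_product_def)
qed

lemma XX_inl_inr_commute:
  assumes G: "group G" and x: "x \<in> carrier G"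
  shows "XX_inl G x \<otimes>\<^bsub>XX G\<^esub> XX_inr G x = XX_inr G x \<otimes>\<^bsub>XX G\<^esub> XX_inl G x"
proof -
  interpret F: group "free_product G G" by (rule group_free_product[OF G G])
  interpret H: group "XX G" by (rule group_XX[OF G])
  interpret q: group_hom "free_product G G" "XX G" "XX_quot G"
    using XX_quot_hom[OF G] by unfold_locales
  let ?N = "normal_closure (free_product G G) (XX_relators G)"
  let ?c = "commutator (free_product G G) (fp_inl G G x) (fp_inr G G x)"
  interpret N: normal ?N "free_product G G"
    by (rule F.normal_closure_normal[OF XX_relators_closed[OF G]])
  have car: "fp_inl G G x \<in> carrier (free_product G G)" "fp_inr G G x \<in> carrier (free_product G G)"
    using hom_in_carrier[OF fp_inl_hom[OF G G] x] hom_in_carrier[OF fp_inr_hom[OF G G] x] by auto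
  have r: "?c \<in> XX_relators G" using x by (auto simp: XX_relators_def)
  \<comment> \<open>The relator is written as its own conjugate by the neutral element, which is the
    form of the generators of \<open>normal_closure\<close>.\<close>
  have "\<one>\<^bsub>free_product G G\<^esub> \<otimes>\<^bsub>free_product G G\<^esub> ?c \<otimes>\<^bsub>free_product G G\<^esub>
      inv\<^bsub>free_product G G\<^esub> \<one>\<^bsub>free_product G G\<^esub> \<in> ?N"
    unfolding normal_closure_def using r by (blast intro: generate.incl F.one_closed)
  then have "?c \<in> ?N" using car by simp
  then have "XX_quot G ?c = \<one>\<^bsub>XX G\<^esub>"
    using N.coset_eq_one_iff[of ?c] car unfolding XX_quot_def XX_def by blast
  then have "commutator (XX G) (XX_inl G x) (XX_inr G x) = \<one>\<^bsub>XX G\<^esub>"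
    using q.hom_commutator[OF car] by (simp add: XX_inl_def XX_inr_def)
  then show ?thesis
    using H.commutator_eq_one_iff car by (simp add: XX_inl_def XX_inr_def)
qed

text \<open>The maps \<open>p1\<close> and \<open>p3\<close> are induced by the pairs (identity,
  trivial) and (trivial, identity), whose values commute; \<open>XX_proj\<close> is the second
  projection.\<close>

lemma XX_weak_commutativity:
  assumes G: "group G"
  obtains p1 p3 where "weak_commutativity (XX G) G (XX_inl G) (XX_inr G) p1 (XX_proj G) p3"
proof -
  interpret G: group G by (rule G)
  interpret H: group "XX G" by (rule group_XX[OF G])
  have id: "(\<lambda>x. x) \<in> hom G G" and triv: "(\<lambda>x. \<one>\<^bsub>G\<^esub>) \<in> hom G G" by (auto intro!: homI)
  from XX_lift[OF G G id triv] obtain p1 where p1: "p1 \<in> hom (XX G) G"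
    "\<And>x. x \<in> carrier G \<Longrightarrow> p1 (XX_inl G x) = x"
    "\<And>x. x \<in> carrier G \<Longrightarrow> p1 (XX_inr G x) = \<one>\<^bsub>G\<^esub>" by auto
  from XX_lift[OF G G triv id] obtain p3 where p3: "p3 \<in> hom (XX G) G"
    "\<And>x. x \<in> carrier G \<Longrightarrow> p3 (XX_inl G x) = \<one>\<^bsub>G\<^esub>"
    "\<And>x. x \<in> carrier G \<Longrightarrow> p3 (XX_inr G x) = x" by auto
  have "weak_commutativity (XX G) G (XX_inl G) (XX_inr G) p1 (XX_proj G) p3"
    using p1 p3 XX_inl_hom[OF G] XX_inr_hom[OF G] XX_proj_hom[OF G]
    by unfold_locales
      (simp_all add: XX_generate[OF G] XX_inl_inr_commute[OF G] XX_proj_inl[OF G] XX_proj_inr[OF G])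
  then show ?thesis by (rule that)
qed

theorem theoremE:
  fixes G :: "('a, 'b) monoid_scheme" and n d s m :: nat
  assumes "group G"
    and "finitely_generated_group G"
    and "engel n G"
    and "d = nilpotency_class (G Mod second_derived G)"
    and "s = L_action_class G"
    and "m = n + d + s + 3"
  shows "engel m (XX G)"
proof -
  obtain p1 p3 where "weak_commutativity (XX G) G (XX_inl G) (XX_inr G) p1 (XX_proj G) p3"
    by (rule XX_weak_commutativity[OF assms(1)])
  then interpret weak_commutativity "XX G" G "XX_inl G" "XX_inr G" p1 "XX_proj G" p3 .
  have L: "XX_L G = L" by (simp add: XX_L_def L_def)
  \<comment> \<open>A \<open>LEAST\<close> has its defining property only if some exponent works;
    \<open>action_nilpotent\<close> provides one.\<close>
  have s: "\<forall>l\<in>L. \<forall>gs. set gs \<subseteq> carrier G \<and> length gs = s \<longrightarrow>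
      iter_commutator (XX G) l (map (XX_inl G) gs) \<in> derived (XX G) L"
    unfolding assms(5) L_action_class_def L by (rule LeastI_ex) (rule action_nilpotent[OF assms(2)])
  show ?thesis
  proof (rule engel_carrier[OF assms(3)])
    show "iter_commutator G a (replicate d g) \<in> second_derived G"
      if "a \<in> carrier G" "g \<in> carrier G" for a g
      unfolding assms(4) by (rule G.engel_second_derived[OF assms(2,3) that])
    show "iter_commutator (XX G) l (replicate s (XX_inl G g)) \<in> commutator_subgroup (XX G) L L"
      if l: "l \<in> L" and g: "g \<in> carrier G" for l g
    proof -
      have "set (replicate s g) \<subseteq> carrier G" using g by auto
      then have "iter_commutator (XX G) l (map (XX_inl G) (replicate s g)) \<in> derived (XX G) L"
        using s[rule_format, OF l, of "replicate s g"] by simp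
      then show ?thesis
        by (simp add: H.derived_eq_commutator_subgroup[OF normal_imp_subgroup[OF normal_L]])
    qed
    \<comment> \<open>The count of commutations stays one below \<open>m\<close>.\<close>
    show "n + s + 2 + d \<le> m" using assms(6) by simp
  qed
qed

end
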